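(* Let $R\in\mathbb{R}$. (1) If $R\le1$, there are no $T^2$-type representations of $\mathcal{A}(R)$ (for any $n,k,\beta,\nu$). Let now $n\ge3$ be an integer, $|\nu|=1$, take $k=1$ and $\alpha=2\pi/n$, and put $\beta'=\beta-\tfrac12\alpha$, normalised so that $\pi-2\pi/n<\beta'\le\pi$. (2) If $1<R\le\sec(\pi/n)$, there is a one-parameter set of irreducible minimal $T^2$-type representations $\Psi(R,n,k=1,\beta,\nu)$, with $\beta$ ranging over $$\pi-\frac{2\pi}{n}+\tfrac12\delta<\beta'<\pi-\tfrac12\delta,\qquad\text{where }\cos(\tfrac12\delta)=R\cos(\pi/n),\ 0\le\delta<2\pi/n.$$ (3) If $R>\sec(\pi/n)$, there is a one-parameter set of irreducible (minimal) $T^2$-type representations $\Psi(R,n,k=1,\beta,\nu)$ with the full range of $\beta$, i.e. $\pi-2\pi/n<\beta'\le\pi$.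
   Context: For $R\in\mathbb{R}$, $\mathcal{A}(R)$ is the unital associative complex algebra generated by $\mathbf{x},\mathbf{y},\mathbf{z},\boldsymbol{\varepsilon},(1+\boldsymbol{\varepsilon}^2)^{-1}$, where $\boldsymbol{\varepsilon}$ is central and $(1+\boldsymbol{\varepsilon}^2)^{-1}$ is the inverse of $1+\boldsymbol{\varepsilon}^2$, subject to $[\mathbf{x},\mathbf{y}]=i\boldsymbol{\varepsilon}\mathbf{z}$, $[\mathbf{y},\mathbf{z}]=i\boldsymbol{\varepsilon}(\mathbf{w}\mathbf{x}+\mathbf{x}\mathbf{w})$, $[\mathbf{z},\mathbf{x}]=i\boldsymbol{\varepsilon}(\mathbf{w}\mathbf{y}+\mathbf{y}\mathbf{w})$, $\mathbf{z}^2+\mathbf{w}^2=1$, where $\mathbf{w}:=\mathbf{x}^2+\mathbf{y}^2-R$. It carries the conjugate-linear anti-multiplicative involution $\dagger$ fixing $\mathbf{x},\mathbf{y},\mathbf{z},\boldsymbol{\varepsilon}$. Put $\mathbf{u}:=\mathbf{w}+i\mathbf{z}$, $\mathbf{a}_\pm:=\mathbf{x}\pm i\mathbf{y}$. Representations considered: irreducible $\Psi:\mathcal{A}(R)\to\mathcal{L}(\mathcal{H},\mathcal{H})$ on an $n$-dimensional complex Hilbert space, with $\Psi(\mathbf{f}^\dagger)=\Psi(\mathbf{f})^\dagger$ for all $\mathbf f$, $\Psi(\boldsymbol{\varepsilon})=\varepsilon\,\mathrm{Id}$ for some real $\varepsilon>0$, and $\Psi(\mathbf{u})$ having no multiple eigenvalues;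 $\alpha\in(0,\pi)$ is defined by $\tan(\tfrac12\alpha)=\varepsilon$. Such a $\Psi$ is a $T^2$-type representation $\Psi(R,n,k,\beta,\nu)$, where $1\le k<n/2$, $\gcd(n,k)=1$, $\beta\in\mathbb{R}$, $|\nu|=1$, if $\alpha=2\pi k/n$ and there are an orthonormal basis $|\beta+m\alpha\rangle$, $m=0,\dots,n-1$, of $\mathcal{H}$ and nonzero constants $C_{\beta+m\alpha}\in\mathbb{C}$, $m=0,\dots,n-1$, with $|C_{\beta+m\alpha}|^2=\sec(\tfrac12\alpha)\cos(\beta-\tfrac12\alpha+m\alpha)+R$, such that (writing $\mathbf{f}$ for $\Psi(\mathbf{f})$) $\mathbf{u}|\beta+m\alpha\rangle=e^{i(\beta+m\alpha)}|\beta+m\alpha\rangle$ for $0\le m\le n-1$; $\mathbf{a}_-|\beta+m\alpha\rangle=C_{\beta+m\alpha}|\beta+(m-1)\alpha\rangle$ for $1\le m\le n-1$; $\mathbf{a}_+|\beta+m\alpha\rangle=\overline{C_{\beta+(m+1)\alpha}}|\beta+(m+1)\alpha\rangle$ for $0\le m\le n-2$; $\mathbf{a}_-|\beta\rangle=C_\beta|\beta+(n-1)\alpha\rangle$ and $\mathbf{a}_+|\beta+(n-1)\alpha\rangle=\overline{C_\beta}|\beta\rangle$; and $\nu=C_{\mathrm{prod}}/|C_{\mathrm{prod}}|$ with $C_{\mathrm{prod}}=\prod_{m=0}^{n-1}C_{\beta+m\alpha}$. It is minimal if $n\alpha=2\pi$, i.e. $k=1$. Up to equivalence $\beta$ may be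 normalised so that $\pi-2\pi/n<\beta-\tfrac12\alpha\le\pi$. *)

theory Defs
  imports
    "HOL-Library.Poly_Mapping"
    "HOL-Algebra.QuotRing"
    "Jordan_Normal_Form.Schur_Decomposition"
    "Jordan_Normal_Form.VS_Connect"
begin

section \<open>The algebra A(R)\<close>

text \<open>
  The free unital associative complex algebra on five letters, as the monoid algebra of the
  free monoid of words. \<open>Einv\<close> is the letter for the inverse of \<open>1 + \<epsilon>\<^sup>2\<close>. Lists are wrapped because
  the convolution product of \<^type>\<open>poly_mapping\<close> wants the monoid in additive notation.
\<close>

datatype letter = X | Y | Z | E | Einv

datatype gword = Word (letters: "letter list")

instantiation gword :: monoid_add
begin
definition zero_gword where "0 = Word []"
definition plus_gword where "v + w = Word (letters v @ letters w)"
instance by standard (simp_all add: zero_gword_def plus_gword_def)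
end

type_synonym free_alg = "gword \<Rightarrow>\<^sub>0 complex"

definition scal :: "complex \<Rightarrow> free_alg" where
  "scal c = Poly_Mapping.single 0 c"

definition gen :: "letter \<Rightarrow> free_alg" where
  "gen g = Poly_Mapping.single (Word [g]) 1"

abbreviation (input) commutator :: "free_alg \<Rightarrow> free_alg \<Rightarrow> free_alg" where
  "commutator f g \<equiv> f * g - g * f"

definition w_el :: "real \<Rightarrow> free_alg" where
  "w_el R = gen X * gen X + gen Y * gen Y - scal (of_real R)"

definition u_el :: "real \<Rightarrow> free_alg" where
  "u_el R = w_el R + scal \<i> * gen Z"

definition a_plus :: free_alg where
  "a_plus = gen X + scal \<i> * gen Y"

definition a_minus :: free_alg where
  "a_minus = gen X - scal \<i> * gen Y"

text \<open>An equation \<open>f = g\<close> is entered as the relator \<open>f - g\<close>. The letter \<open>Einv\<close> is a two-sided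
  inverse, so it is central in the quotient because \<open>E\<close> is.\<close>

definition relators :: "real \<Rightarrow> free_alg set" where
  "relators R =
    {commutator (gen E) (gen X), commutator (gen E) (gen Y), commutator (gen E) (gen Z),
     (1 + gen E * gen E) * gen Einv - 1,
     gen Einv * (1 + gen E * gen E) - 1,
     commutator (gen X) (gen Y) - scal \<i> * gen E * gen Z,
     commutator (gen Y) (gen Z) - scal \<i> * gen E * (w_el R * gen X + gen X * w_el R),
     commutator (gen Z) (gen X) - scal \<i> * gen E * (w_el R * gen Y + gen Y * w_el R),
     gen Z * gen Z + w_el R * w_el R - 1}"

definition rel_ideal :: "real \<Rightarrow> free_alg set" where
  "rel_ideal R = Idl\<^bsub>class_ring\<^esub> (relators R)"

definition alg_A :: "real \<Rightarrow> free_alg set ring" where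
  "alg_A R = class_ring Quot (rel_ideal R)"

definition cls :: "real \<Rightarrow> free_alg \<Rightarrow> free_alg set" where
  "cls R f = rel_ideal R +>\<^bsub>class_ring\<^esub> f"

subsection \<open>The involution\<close>

definition rev_word :: "gword \<Rightarrow> gword" where
  "rev_word w = Word (rev (letters w))"

definition star :: "free_alg \<Rightarrow> free_alg" where
  "star f = Poly_Mapping.map cnj (Poly_Mapping.map_key rev_word f)"

text \<open>The involution on the quotient; \<open>dagger_cls\<close> below shows that it is well defined.\<close>

definition dagger :: "free_alg set \<Rightarrow> free_alg set" where
  "dagger F = star ` F"

lemma rev_word_rev_word [simp]: "rev_word (rev_word w) = w"
  by (simp add: rev_word_def)

lemma inj_rev_word: "inj rev_word"
  by (metis injI rev_word_rev_word)

lemma rev_word_add: "rev_word (v + w) = rev_word w + rev_word v"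
  by (simp add: rev_word_def plus_gword_def)

lemma rev_word_0 [simp]: "rev_word 0 = 0"
  by (simp add: rev_word_def zero_gword_def)

lemma lookup_star: "Poly_Mapping.lookup (star f) w = cnj (Poly_Mapping.lookup f (rev_word w))"
  by (simp add: star_def Poly_Mapping.map.rep_eq map_key.rep_eq inj_rev_word when_def)

lemma star_star [simp]: "star (star f) = f"
  by (rule poly_mapping_eqI) (simp add: lookup_star)

lemma star_add: "star (f + g) = star f + star g"
  by (rule poly_mapping_eqI) (simp add: lookup_star lookup_add)

lemma star_diff: "star (f - g) = star f - star g"
  by (rule poly_mapping_eqI) (simp add: lookup_star lookup_minus)

lemma star_0 [simp]: "star 0 = 0"
  by (rule poly_mapping_eqI) (simp add: lookup_star)

lemma star_single: "star (Poly_Mapping.single w c) = Poly_Mapping.single (rev_word w) (cnj c)"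
  by (rule poly_mapping_eqI) (auto simp: lookup_star lookup_single when_def)

lemma star_scal [simp]: "star (scal c) = scal (cnj c)"
  by (simp add: scal_def star_single)

lemma star_gen [simp]: "star (gen g) = gen g"
  by (simp add: gen_def star_single) (simp add: rev_word_def)

lemma star_1 [simp]: "star 1 = 1"
  using star_single[of 0 1] by (simp add: single_one)

lemma free_alg_induct [case_names zero single add]:
  fixes f :: free_alg
  assumes "P 0" and "\<And>w c. P (Poly_Mapping.single w c)"
    and "\<And>f g. P f \<Longrightarrow> P g \<Longrightarrow> P (f + g)"
  shows "P f"
proof -
  have "P (\<Sum>w\<in>A. Poly_Mapping.single w (Poly_Mapping.lookup f w))" if "finite A" for A
    using that by (induction A) (auto intro: assms)
  moreover have "(\<Sum>w\<in>Poly_Mapping.keys f. Poly_Mapping.single w (Poly_Mapping.lookup f w)) = f"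
    by (rule poly_mapping_eqI)
      (auto simp: lookup_sum lookup_single when_def in_keys_iff sum.delta)
  ultimately show ?thesis
    by (metis finite_keys)
qed

lemma star_mult: "star (f * g) = star g * star f"
proof (induction f rule: free_alg_induct)
  case (single v c)
  show ?case
    by (induction g rule: free_alg_induct)
      (simp_all add: mult_single star_single rev_word_add star_add distrib_left distrib_right
        mult.commute)
qed (simp_all add: star_add distrib_left distrib_right)

lemma scal_mult_commute: "scal c * f = f * scal c"
  by (induction f rule: free_alg_induct)
    (simp_all add: scal_def mult_single distrib_left distrib_right mult.commute)

lemma ideal_rel_ideal: "ideal (rel_ideal R) class_ring"
  unfolding rel_ideal_def by (rule ring.genideal_ideal[OF class_ring.ring_axioms]) simp

lemma relators_subset: "relators R \<subseteq> rel_ideal R"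
  unfolding rel_ideal_def by (rule ring.genideal_self[OF class_ring.ring_axioms]) simp

lemma rel_ideal_closed:
  shows "0 \<in> rel_ideal R"
    and "f \<in> rel_ideal R \<Longrightarrow> g \<in> rel_ideal R \<Longrightarrow> f + g \<in> rel_ideal R"
    and "f \<in> rel_ideal R \<Longrightarrow> - f \<in> rel_ideal R"
    and "f \<in> rel_ideal R \<Longrightarrow> h * f \<in> rel_ideal R"
    and "f \<in> rel_ideal R \<Longrightarrow> f * h \<in> rel_ideal R"
proof -
  interpret I: ideal "rel_ideal R" class_ring by (rule ideal_rel_ideal)
  show "0 \<in> rel_ideal R" using I.zero_closed by simp
  show "f \<in> rel_ideal R \<Longrightarrow> g \<in> rel_ideal R \<Longrightarrow> f + g \<in> rel_ideal R"
    using I.a_closed by simp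
  show "f \<in> rel_ideal R \<Longrightarrow> - f \<in> rel_ideal R"
    using I.a_inv_closed by (simp add: class_ring_simps)
  show "f \<in> rel_ideal R \<Longrightarrow> h * f \<in> rel_ideal R" using I.I_l_closed by simp
  show "f \<in> rel_ideal R \<Longrightarrow> f * h \<in> rel_ideal R" using I.I_r_closed by simp
qed

lemma rel_ideal_diff: "f \<in> rel_ideal R \<Longrightarrow> g \<in> rel_ideal R \<Longrightarrow> f - g \<in> rel_ideal R"
  using rel_ideal_closed(2)[of f R "- g"] rel_ideal_closed(3) by simp

lemma E_commute:
  shows "g \<in> {X, Y, Z} \<Longrightarrow> commutator (gen E) (gen g) \<in> rel_ideal R"
    and "commutator (gen E) f \<in> rel_ideal R \<Longrightarrow> commutator (gen E) f' \<in> rel_ideal R \<Longrightarrow>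
      commutator (gen E) (f + f') \<in> rel_ideal R"
    and "commutator (gen E) f \<in> rel_ideal R \<Longrightarrow> commutator (gen E) f' \<in> rel_ideal R \<Longrightarrow>
      commutator (gen E) (f - f') \<in> rel_ideal R"
    and "commutator (gen E) f \<in> rel_ideal R \<Longrightarrow> commutator (gen E) f' \<in> rel_ideal R \<Longrightarrow>
      commutator (gen E) (f * f') \<in> rel_ideal R"
    and "commutator (gen E) (scal c) \<in> rel_ideal R"
proof -
  show "commutator (gen E) (gen g) \<in> rel_ideal R" if "g \<in> {X, Y, Z}"
    using that relators_subset[of R] by (auto simp: relators_def)
  show "commutator (gen E) (scal c) \<in> rel_ideal R"
    by (simp add: scal_mult_commute rel_ideal_closed)
next
  assume f: "commutator (gen E) f \<in> rel_ideal R" and f': "commutator (gen E) f' \<in> rel_ideal R"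
  have "commutator (gen E) (f + f') = commutator (gen E) f + commutator (gen E) f'"
    by (simp add: algebra_simps)
  with f f' show "commutator (gen E) (f + f') \<in> rel_ideal R"
    by (simp only: rel_ideal_closed)
  have "commutator (gen E) (f - f') = commutator (gen E) f - commutator (gen E) f'"
    by (simp add: algebra_simps)
  with f f' show "commutator (gen E) (f - f') \<in> rel_ideal R"
    by (simp only: rel_ideal_diff)
  have "commutator (gen E) (f * f') = commutator (gen E) f * f' + f * commutator (gen E) f'"
    by (simp add: algebra_simps)
  with f f' show "commutator (gen E) (f * f') \<in> rel_ideal R"
    by (simp only: rel_ideal_closed)
qed

lemma star_w_el [simp]: "star (w_el R) = w_el R"
  by (simp add: w_el_def star_add star_diff star_mult)

lemma star_commutator_relator:
  assumes rel: "commutator f g - scal \<i> * gen E * h \<in> rel_ideal R"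
    and h: "commutator (gen E) h \<in> rel_ideal R"
    and [simp]: "star f = f" "star g = g" "star h = h"
  shows "star (commutator f g - scal \<i> * gen E * h) \<in> rel_ideal R"
proof -
  have "scal (- \<i>) = - scal \<i>"
    by (simp add: scal_def single_uminus)
  then have "star (commutator f g - scal \<i> * gen E * h) =
      - commutator f g + scal \<i> * (h * gen E)"
    using scal_mult_commute[of \<i> "h * gen E"]
    by (simp add: star_diff star_mult mult.assoc)
  also have "\<dots> = - (commutator f g - scal \<i> * gen E * h) - scal \<i> * commutator (gen E) h"
    by (simp add: algebra_simps)
  finally have "star (commutator f g - scal \<i> * gen E * h) =
      - (commutator f g - scal \<i> * gen E * h) - scal \<i> * commutator (gen E) h" .
  then show ?thesis
    using rel h by (simp only: rel_ideal_diff rel_ideal_closed)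
qed

lemma star_relators:
  assumes "r \<in> relators R"
  shows "star r \<in> rel_ideal R"
proof -
  have rel: "\<And>r. r \<in> relators R \<Longrightarrow> r \<in> rel_ideal R"
    using relators_subset by blast
  have w: "commutator (gen E) (w_el R) \<in> rel_ideal R"
    unfolding w_el_def by (intro E_commute) auto
  have c: "star (commutator (gen E) (gen g)) \<in> rel_ideal R" if "g \<in> {X, Y, Z}" for g
    using rel_ideal_closed(3)[OF E_commute(1)[OF that]]
    by (simp add: star_diff star_mult)
  have 1: "star (commutator (gen X) (gen Y) - scal \<i> * gen E * gen Z) \<in> rel_ideal R"
    by (rule star_commutator_relator) (auto intro: rel E_commute simp: relators_def)
  have 2: "star (commutator (gen Y) (gen Z)
      - scal \<i> * gen E * (w_el R * gen X + gen X * w_el R)) \<in> rel_ideal R"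
    by (rule star_commutator_relator)
      (auto intro: rel E_commute w simp: relators_def star_add star_mult add.commute)
  have 3: "star (commutator (gen Z) (gen X)
      - scal \<i> * gen E * (w_el R * gen Y + gen Y * w_el R)) \<in> rel_ideal R"
    by (rule star_commutator_relator)
      (auto intro: rel E_commute w simp: relators_def star_add star_mult add.commute)
  have 4: "star ((1 + gen E * gen E) * gen Einv - 1) \<in> rel_ideal R"
    "star (gen Einv * (1 + gen E * gen E) - 1) \<in> rel_ideal R"
    "star (gen Z * gen Z + w_el R * w_el R - 1) \<in> rel_ideal R"
    by (auto intro!: rel simp: relators_def star_add star_diff star_mult)
  show ?thesis
    using assms c 1 2 3 4 unfolding relators_def by blast
qed

lemma star_rel_ideal:
  assumes "f \<in> rel_ideal R"
  shows "star f \<in> rel_ideal R"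
proof -
  let ?J = "{f. star f \<in> rel_ideal R}"
  have neg: "star (- f) = - star f" for f
    using star_diff[of 0 f] by simp
  have "ideal ?J class_ring"
  proof (rule idealI[OF class_ring.ring_axioms])
    have inv: "m_inv (add_monoid class_ring) f = - f" for f :: free_alg
      using class_ring_simps(8)[where ?'a = free_alg] by (simp add: a_inv_def)
    show "subgroup ?J (add_monoid class_ring)"
      by (rule subgroup.intro; simp add: star_add neg rel_ideal_closed inv[simplified])
  qed (auto simp: star_mult rel_ideal_closed)
  moreover have "relators R \<subseteq> ?J"
    using star_relators by blast
  ultimately have "rel_ideal R \<subseteq> ?J"
    unfolding rel_ideal_def by (rule ring.genideal_minimal[OF class_ring.ring_axioms])
  with assms show ?thesis
    by blast
qed

lemma dagger_cls: "dagger (cls R f) = cls R (star f)"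
proof -
  have cls: "cls R g = (\<lambda>h. h + g) ` rel_ideal R" for g
    by (auto simp: cls_def a_r_coset_def r_coset_def)
  have "star ` rel_ideal R = rel_ideal R"
  proof
    show "rel_ideal R \<subseteq> star ` rel_ideal R"
      using star_rel_ideal star_star by (metis image_eqI subsetI)
  qed (use star_rel_ideal in blast)
  moreover have "dagger (cls R f) = (\<lambda>h. h + star f) ` (star ` rel_ideal R)"
    by (simp add: dagger_def cls image_image star_add)
  ultimately show ?thesis
    by (simp add: cls)
qed

section \<open>Representations on the Hilbert space of column vectors of length n\<close>

definition representation :: "real \<Rightarrow> nat \<Rightarrow> (free_alg set \<Rightarrow> complex mat) \<Rightarrow> bool" where
  "representation R n \<Psi> \<longleftrightarrow>
    \<Psi> \<in> Ring.ring_hom (alg_A R) (ring_mat TYPE(complex) n ()) \<and>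
    (\<forall>c. \<forall>F\<in>carrier (alg_A R). \<Psi> (cls R (scal c) \<otimes>\<^bsub>alg_A R\<^esub> F) = c \<cdot>\<^sub>m \<Psi> F)"

definition irreducible_rep :: "real \<Rightarrow> nat \<Rightarrow> (free_alg set \<Rightarrow> complex mat) \<Rightarrow> bool" where
  "irreducible_rep R n \<Psi> \<longleftrightarrow> n > 0 \<and>
    (\<forall>W. VectorSpace.subspace class_ring W (module_vec TYPE(complex) n) \<and>
      (\<forall>F\<in>carrier (alg_A R). \<forall>v\<in>W. \<Psi> F *\<^sub>v v \<in> W) \<longrightarrow>
      W = {0\<^sub>v n} \<or> W = carrier_vec n)"

definition admissible_rep :: "real \<Rightarrow> nat \<Rightarrow> (free_alg set \<Rightarrow> complex mat) \<Rightarrow> bool" where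
  "admissible_rep R n \<Psi> \<longleftrightarrow>
    representation R n \<Psi> \<and>
    irreducible_rep R n \<Psi> \<and>
    (\<forall>F\<in>carrier (alg_A R). \<Psi> (dagger F) = mat_adjoint (\<Psi> F)) \<and>
    (\<exists>\<epsilon>::real. \<epsilon> > 0 \<and> \<Psi> (cls R (gen E)) = of_real \<epsilon> \<cdot>\<^sub>m 1\<^sub>m n) \<and>
    (\<forall>\<mu>. eigenvalue (\<Psi> (cls R (u_el R))) \<mu> \<longrightarrow>
      Polynomial.order \<mu> (char_poly (\<Psi> (cls R (u_el R)))) = 1)"

definition rep_angle :: "real \<Rightarrow> nat \<Rightarrow> (free_alg set \<Rightarrow> complex mat) \<Rightarrow> real \<Rightarrow> bool" where
  "rep_angle R n \<Psi> \<alpha> \<longleftrightarrow>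
    0 < \<alpha> \<and> \<alpha> < pi \<and> \<Psi> (cls R (gen E)) = of_real (tan (\<alpha> / 2)) \<cdot>\<^sub>m 1\<^sub>m n"

definition sec :: "real \<Rightarrow> real" where
  "sec t = 1 / cos t"

text \<open>\<open>v m\<close> is the basis vector labelled \<open>\<beta> + m\<alpha>\<close> and \<open>C m\<close> the constant with that label. An orthonormal
  family of \<open>n\<close> vectors of length \<open>n\<close> is automatically a basis.\<close>

definition T2_rep ::
  "real \<Rightarrow> nat \<Rightarrow> nat \<Rightarrow> real \<Rightarrow> complex \<Rightarrow> (free_alg set \<Rightarrow> complex mat) \<Rightarrow> bool" where
  "T2_rep R n k \<beta> \<nu> \<Psi> \<longleftrightarrow>
    admissible_rep R n \<Psi> \<and>
    1 \<le> k \<and> 2 * k < n \<and> coprime n k \<and> cmod \<nu> = 1 \<and>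
    (\<exists>\<alpha> (v :: nat \<Rightarrow> complex vec) (C :: nat \<Rightarrow> complex).
      let u = \<Psi> (cls R (u_el R)); am = \<Psi> (cls R a_minus); ap = \<Psi> (cls R a_plus) in
      rep_angle R n \<Psi> \<alpha> \<and> \<alpha> = 2 * pi * real k / real n \<and>
      (\<forall>m<n. v m \<in> carrier_vec n) \<and>
      (\<forall>l<n. \<forall>m<n. v l \<bullet>c v m = (if l = m then 1 else 0)) \<and>
      (\<forall>m<n. C m \<noteq> 0 \<and>
        (cmod (C m))\<^sup>2 = sec (\<alpha> / 2) * cos (\<beta> - \<alpha> / 2 + real m * \<alpha>) + R) \<and>
      (\<forall>m<n. u *\<^sub>v v m = exp (\<i> * of_real (\<beta> + real m * \<alpha>)) \<cdot>\<^sub>v v m) \<and>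
      (\<forall>m. 1 \<le> m \<and> m < n \<longrightarrow> am *\<^sub>v v m = C m \<cdot>\<^sub>v v (m - 1)) \<and>
      (\<forall>m. m + 1 < n \<longrightarrow> ap *\<^sub>v v m = cnj (C (m + 1)) \<cdot>\<^sub>v v (m + 1)) \<and>
      am *\<^sub>v v 0 = C 0 \<cdot>\<^sub>v v (n - 1) \<and>
      ap *\<^sub>v v (n - 1) = cnj (C 0) \<cdot>\<^sub>v v 0 \<and>
      \<nu> = (\<Prod>m<n. C m) / of_real (cmod (\<Prod>m<n. C m)))"

definition minimal_rep :: "real \<Rightarrow> nat \<Rightarrow> (free_alg set \<Rightarrow> complex mat) \<Rightarrow> bool" where
  "minimal_rep R n \<Psi> \<longleftrightarrow> (\<exists>\<alpha>. rep_angle R n \<Psi> \<alpha> \<and> real n * \<alpha> = 2 * pi)"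

definition equivalent_reps ::
  "real \<Rightarrow> nat \<Rightarrow> (free_alg set \<Rightarrow> complex mat) \<Rightarrow> (free_alg set \<Rightarrow> complex mat) \<Rightarrow> bool" where
  "equivalent_reps R n \<Psi> \<Phi> \<longleftrightarrow>
    (\<exists>U\<in>carrier_mat n n. mat_adjoint U * U = 1\<^sub>m n \<and> U * mat_adjoint U = 1\<^sub>m n \<and>
      (\<forall>F\<in>carrier (alg_A R). U * \<Psi> F = \<Phi> F * U))"

definition normalised_betas :: "nat \<Rightarrow> real set" where
  "normalised_betas n =
    {\<beta>. let \<alpha> = 2 * pi / real n; \<beta>' = \<beta> - \<alpha> / 2 in pi - 2 * pi / real n < \<beta>' \<and> \<beta>' \<le> pi}"

text \<open>For fixed \<open>R\<close>, \<open>n\<close>, \<open>\<nu>\<close>, the set \<open>B\<close> is the exact range of the parameter \<open>\<beta>\<close>: there is a family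
  over \<open>B\<close> whose members are pairwise inequivalent, and no other normalised \<open>\<beta>\<close> occurs.\<close>

definition minimal_T2_family :: "real \<Rightarrow> nat \<Rightarrow> complex \<Rightarrow> real set \<Rightarrow> bool" where
  "minimal_T2_family R n \<nu> B \<longleftrightarrow>
    (\<exists>\<Psi>. (\<forall>\<beta>\<in>B. irreducible_rep R n (\<Psi> \<beta>) \<and> T2_rep R n 1 \<beta> \<nu> (\<Psi> \<beta>) \<and> minimal_rep R n (\<Psi> \<beta>)) \<and>
      (\<forall>\<beta>\<in>B. \<forall>\<gamma>\<in>B. \<beta> \<noteq> \<gamma> \<longrightarrow> \<not> equivalent_reps R n (\<Psi> \<beta>) (\<Psi> \<gamma>))) \<and>
    (\<forall>\<beta>\<in>normalised_betas n - B. \<not> (\<exists>\<Psi>. T2_rep R n 1 \<beta> \<nu> \<Psi>))"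

end

theory Submission
  imports Defs
begin

text \<open>
  On a \<open>T\<^sup>2\<close>-type representation every \<open>|C|\<^sup>2 = sec (\<alpha>/2) cos (\<beta>' + m\<alpha>) + R\<close> is positive. As \<open>n\<close> and \<open>k\<close> are
  coprime, the angles \<open>\<beta>' + m\<alpha>\<close> run over a full coset of the multiples of \<open>2\<pi>/n\<close>, so one of them is
  within \<open>\<pi>/n\<close> of \<open>\<pi>\<close>; this forces \<open>R > 1\<close> and, for \<open>k = 1\<close>, cuts out the stated range of \<open>\<beta>\<close>. Conversely,
  positivity for all \<open>m\<close> lets one choose the \<open>C m\<close> with any prescribed phase of their product. The weighted
  cyclic shift \<open>a\<^sub>+\<close>, its adjoint \<open>a\<^sub>-\<close>, and the diagonal matrices \<open>sin\<close> and \<open>cos\<close> of the angles for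
  \<open>z\<close> and \<open>w\<close> then satisfy the relations. Inequivalence is read off the spectrum of \<open>u\<close>.
\<close>

section \<open>Adjoints and scalar multiples of complex matrices\<close>

lemma mat_adjoint_dim [simp]:
  "dim_row (mat_adjoint A) = dim_col A" "dim_col (mat_adjoint A) = dim_row A"
  by (simp_all add: mat_adjoint_def)

lemma mat_adjoint_index:
  fixes A :: "complex mat"
  assumes "i < dim_col A" "j < dim_row A"
  shows "mat_adjoint A $$ (i, j) = cnj (A $$ (j, i))"
  using assms by (simp add: mat_adjoint_def mat_of_rows_index)

lemma mat_adjoint_mult:
  fixes A B :: "complex mat"
  assumes "A \<in> carrier_mat n m" "B \<in> carrier_mat m l"
  shows "mat_adjoint (A * B) = mat_adjoint B * mat_adjoint A"
  using assms by (intro eq_matI) (auto simp: mat_adjoint_index scalar_prod_def mult.commute intro!: sum.cong)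

lemma mat_adjoint_add:
  fixes A B :: "complex mat"
  assumes "A \<in> carrier_mat n m" "B \<in> carrier_mat n m"
  shows "mat_adjoint (A + B) = mat_adjoint A + mat_adjoint B"
  using assms by (intro eq_matI) (auto simp: mat_adjoint_index)

lemma mat_adjoint_smult:
  fixes A :: "complex mat"
  assumes "A \<in> carrier_mat n m"
  shows "mat_adjoint (c \<cdot>\<^sub>m A) = cnj c \<cdot>\<^sub>m mat_adjoint A"
  using assms by (intro eq_matI) (auto simp: mat_adjoint_index)

lemma mat_adjoint_one: "mat_adjoint (1\<^sub>m n :: complex mat) = 1\<^sub>m n"
  by (intro eq_matI) (auto simp: mat_adjoint_index)

lemma one_smult_mat: "1 \<cdot>\<^sub>m A = (A :: 'a :: semiring_1 mat)"
  by (intro eq_matI) auto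

lemma smult_smult_mat: "c \<cdot>\<^sub>m (d \<cdot>\<^sub>m A) = (c * d) \<cdot>\<^sub>m (A :: 'a :: semigroup_mult mat)"
  by (intro eq_matI) (auto simp: mult.assoc)

section \<open>Evaluation of the free algebra at matrices\<close>

definition word_mat :: "nat \<Rightarrow> (letter \<Rightarrow> complex mat) \<Rightarrow> letter list \<Rightarrow> complex mat" where
  "word_mat n M gs = foldr (\<lambda>g A. M g * A) gs (1\<^sub>m n)"

text \<open>The sum is taken entrywise because matrices of a fixed size do not form a type of class ring.\<close>

definition eval_mat :: "nat \<Rightarrow> (letter \<Rightarrow> complex mat) \<Rightarrow> free_alg \<Rightarrow> complex mat" where
  "eval_mat n M f = Matrix.mat n n (\<lambda>ij.
    \<Sum>w\<in>Poly_Mapping.keys f. Poly_Mapping.lookup f w * word_mat n M (letters w) $$ ij)"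

text \<open>The map that \<^const>\<open>eval_mat\<close> induces on cosets; on a coset on which \<^const>\<open>eval_mat\<close> is not
  constant, \<^const>\<open>the_elem\<close> gives a junk value.\<close>

definition eval_cls :: "nat \<Rightarrow> (letter \<Rightarrow> complex mat) \<Rightarrow> free_alg set \<Rightarrow> complex mat" where
  "eval_cls n M F = the_elem (eval_mat n M ` F)"

locale matrix_assignment =
  fixes n :: nat and M :: "letter \<Rightarrow> complex mat"
  assumes M_carrier [simp]: "M g \<in> carrier_mat n n"
begin

abbreviation "ev \<equiv> eval_mat n M"

lemma word_mat_carrier [simp]: "word_mat n M gs \<in> carrier_mat n n"
  unfolding word_mat_def
  by (induction gs) (simp_all add: mult_carrier_mat[OF M_carrier])

lemma word_mat_dim [simp]:
  "dim_row (word_mat n M gs) = n" "dim_col (word_mat n M gs) = n"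
  using carrier_matD[OF word_mat_carrier] by blast+

lemma word_mat_append: "word_mat n M (gs @ hs) = word_mat n M gs * word_mat n M hs"
proof (induction gs)
  case Nil
  then show ?case
    using left_mult_one_mat[OF word_mat_carrier] by (simp add: word_mat_def)
next
  case (Cons g gs)
  have c: "word_mat n M (g # hs) = M g * word_mat n M hs" for g hs
    by (simp add: word_mat_def)
  show ?case
    using Cons assoc_mult_mat[OF M_carrier word_mat_carrier word_mat_carrier] by (simp add: c)
qed

lemma ev_carrier [simp]: "ev f \<in> carrier_mat n n"
  by (simp add: eval_mat_def)

lemma ev_dim [simp]: "dim_row (ev f) = n" "dim_col (ev f) = n"
  by (simp_all add: eval_mat_def)

lemma ev_index:
  assumes "finite S" "Poly_Mapping.keys f \<subseteq> S" "i < n" "j < n"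
  shows "ev f $$ (i, j) =
    (\<Sum>w\<in>S. Poly_Mapping.lookup f w * word_mat n M (letters w) $$ (i, j))"
  using assms by (auto simp: eval_mat_def in_keys_iff intro!: sum.mono_neutral_left)

lemma ev_add: "ev (f + g) = ev f + ev g"
proof (rule eq_matI)
  fix i j
  assume "i < dim_row (ev f + ev g)" "j < dim_col (ev f + ev g)"
  then have ij: "i < n" "j < n"
    by simp_all
  let ?S = "Poly_Mapping.keys f \<union> Poly_Mapping.keys g"
  have "Poly_Mapping.keys (f + g) \<subseteq> ?S"
    by (rule Poly_Mapping.keys_add)
  then show "ev (f + g) $$ (i, j) = (ev f + ev g) $$ (i, j)"
    using ij by (simp add: ev_index[of ?S] lookup_add sum.distrib distrib_right)
qed simp_all

lemma ev_zero: "ev 0 = 0\<^sub>m n n"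
  by (intro eq_matI) (auto simp: eval_mat_def)

lemma ev_single: "ev (Poly_Mapping.single w c) = c \<cdot>\<^sub>m word_mat n M (letters w)"
proof (rule eq_matI)
  fix i j
  assume "i < dim_row (c \<cdot>\<^sub>m word_mat n M (letters w))" "j < dim_col (c \<cdot>\<^sub>m word_mat n M (letters w))"
  then have ij: "i < n" "j < n"
    by simp_all
  then show "ev (Poly_Mapping.single w c) $$ (i, j) = (c \<cdot>\<^sub>m word_mat n M (letters w)) $$ (i, j)"
    by (subst ev_index[of "{w}"]) auto
qed simp_all

lemma ev_scal: "ev (scal c) = c \<cdot>\<^sub>m 1\<^sub>m n"
  by (simp add: scal_def ev_single zero_gword_def) (simp add: word_mat_def)

lemma ev_one: "ev 1 = 1\<^sub>m n"
  using ev_scal[of 1] by (simp add: scal_def single_one one_smult_mat)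

lemma ev_gen: "ev (gen g) = M g"
  by (simp add: gen_def ev_single one_smult_mat)
    (simp add: word_mat_def right_mult_one_mat[OF M_carrier])

text \<open>Both sides are biadditive, so a double induction leaves two monomials, where
  concatenation of words becomes the matrix product.\<close>

lemma ev_mult: "ev (f * g) = ev f * ev g"
proof (induction f rule: free_alg_induct)
  case zero
  show ?case
    using left_mult_zero_mat[OF ev_carrier] by (simp add: ev_zero)
next
  case (single v c)
  show ?case
  proof (induction g rule: free_alg_induct)
    case zero
    show ?case
      using right_mult_zero_mat[OF ev_carrier] by (simp add: ev_zero)
  next
    case (single w d)
    have "ev (Poly_Mapping.single v c) * ev (Poly_Mapping.single w d) =
        c \<cdot>\<^sub>m (d \<cdot>\<^sub>m (word_mat n M (letters v) * word_mat n M (letters w)))"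
      by (simp add: ev_single mult_smult_assoc_mat[where nr = n and n = n and nc = n]
        mult_smult_distrib[where nr = n and n = n and nc = n] smult_smult_mat mult.commute)
    then show ?case
      by (simp add: mult_single ev_single plus_gword_def word_mat_append smult_smult_mat)
  next
    case (add g h)
    then show ?case
      by (simp add: distrib_left ev_add mult_add_distrib_mat[where nr = n and n = n and nc = n])
  qed
next
  case (add f h)
  then show ?case
    by (simp add: distrib_right ev_add add_mult_distrib_mat[where nr = n and n = n and nc = n])
qed

lemma ev_scal_mult: "ev (scal c * f) = c \<cdot>\<^sub>m ev f"
  by (simp add: ev_mult ev_scal mult_smult_assoc_mat[where nr = n and n = n and nc = n]
    left_mult_one_mat[where nr = n and nc = n])

lemma ev_diff: "ev (f - g) = ev f - ev g"
proof (rule eq_matI)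
  fix i j
  assume ij: "i < dim_row (ev f - ev g)" "j < dim_col (ev f - ev g)"
  have "ev f = ev (f - g) + ev g"
    by (simp flip: ev_add)
  then show "ev (f - g) $$ (i, j) = (ev f - ev g) $$ (i, j)"
    using ij by simp
qed simp_all

text \<open>Reversing a word reverses the product of its matrices, as taking adjoints does, and each
  Hermitian factor is its own adjoint.\<close>

lemma ev_star:
  assumes herm: "\<And>g. mat_adjoint (M g) = M g"
  shows "ev (star f) = mat_adjoint (ev f)"
proof (induction f rule: free_alg_induct)
  case zero
  show ?case
    by (auto simp: ev_zero mat_adjoint_index intro!: eq_matI)
next
  case (single w c)
  have "word_mat n M (rev gs) = mat_adjoint (word_mat n M gs)" for gs
  proof (induction gs)
    case Nil
    show ?case
      by (simp add: word_mat_def mat_adjoint_one)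
  next
    case (Cons g gs)
    have "word_mat n M [g] = M g" "word_mat n M (g # gs) = M g * word_mat n M gs"
      by (simp_all add: word_mat_def right_mult_one_mat[OF M_carrier])
    then show ?case
      by (simp add: word_mat_append Cons herm mat_adjoint_mult[where n = n and m = n and l = n])
  qed
  then show ?case
    by (simp add: star_single ev_single rev_word_def mat_adjoint_smult[where n = n and m = n])
next
  case (add f g)
  then show ?case
    by (simp add: star_add ev_add mat_adjoint_add[where n = n and m = n])
qed

text \<open>The kernel of evaluation is a two-sided ideal, and \<open>rel_ideal\<close> is the
  smallest one that contains the relators.\<close>

lemma ev_rel_ideal:
  assumes "\<And>r. r \<in> relators R \<Longrightarrow> ev r = 0\<^sub>m n n" and "f \<in> rel_ideal R"
  shows "ev f = 0\<^sub>m n n"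
proof -
  let ?J = "{f. ev f = 0\<^sub>m n n}"
  have neg: "ev (- f) = 0\<^sub>m n n - ev f" for f
    using ev_diff[of 0 f] by (simp add: ev_zero)
  have "ideal ?J class_ring"
  proof (rule idealI[OF class_ring.ring_axioms])
    have inv: "m_inv (add_monoid class_ring) f = - f" for f :: free_alg
      using class_ring_simps(8)[where ?'a = free_alg] by (simp add: a_inv_def)
    show "subgroup ?J (add_monoid class_ring)"
      by (rule subgroup.intro; simp add: ev_add ev_zero neg inv[simplified])
  qed (auto simp: ev_mult left_mult_zero_mat[OF ev_carrier] right_mult_zero_mat[OF ev_carrier])
  then have "rel_ideal R \<subseteq> ?J"
    unfolding rel_ideal_def using assms(1)
    by (intro ring.genideal_minimal[OF class_ring.ring_axioms]) auto
  with assms(2) show ?thesis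
    by blast
qed

end

section \<open>Passage to the quotient algebra\<close>

lemma cls_eq: "cls R f = (\<lambda>h. h + f) ` rel_ideal R"
  by (auto simp: cls_def a_r_coset_def r_coset_def)

lemma carrier_alg_A: "carrier (alg_A R) = range (cls R)"
  by (auto simp: alg_A_def FactRing_def A_RCOSETS_def RCOSETS_def cls_def a_r_coset_def)

lemma alg_A_ops:
  "cls R f \<otimes>\<^bsub>alg_A R\<^esub> cls R g = cls R (f * g)"
  "cls R f \<oplus>\<^bsub>alg_A R\<^esub> cls R g = cls R (f + g)"
  "\<one>\<^bsub>alg_A R\<^esub> = cls R 1"
proof -
  interpret I: ideal "rel_ideal R" class_ring by (rule ideal_rel_ideal)
  show "cls R f \<otimes>\<^bsub>alg_A R\<^esub> cls R g = cls R (f * g)"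
    using I.rcoset_mult_add[of f g] by (simp add: alg_A_def FactRing_def cls_def)
  show "cls R f \<oplus>\<^bsub>alg_A R\<^esub> cls R g = cls R (f + g)"
    using I.a_rcos_sum[of f g] by (simp add: alg_A_def FactRing_def cls_def)
  show "\<one>\<^bsub>alg_A R\<^esub> = cls R 1"
    by (simp add: alg_A_def FactRing_def cls_def)
qed

locale relator_model = matrix_assignment +
  fixes R :: real
  assumes ev_relators: "r \<in> relators R \<Longrightarrow> ev r = 0\<^sub>m n n"
begin

lemma eval_cls: "eval_cls n M (cls R f) = ev f"
proof -
  have "ev (h + f) = ev f" if "h \<in> rel_ideal R" for h
    using ev_rel_ideal[OF ev_relators that] by (simp add: ev_add)
  \<comment> \<open>The ideal contains 0, so the image is not empty and is a genuine singleton for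
    \<open>the_elem\<close>.\<close>
  then have "ev ` cls R f = {ev f}"
    using rel_ideal_closed(1)[of R] by (force simp: cls_eq image_image)
  then show ?thesis
    by (simp add: eval_cls_def)
qed

lemma representation_eval_cls: "representation R n (eval_cls n M)"
  unfolding representation_def Ring.ring_hom_def ring_mat_simps
  by (auto simp: carrier_alg_A alg_A_ops eval_cls ev_mult ev_add ev_one ring_mat_simps
    simp flip: ev_scal_mult)

lemma eval_cls_dagger:
  assumes "\<And>g. mat_adjoint (M g) = M g" "F \<in> carrier (alg_A R)"
  shows "eval_cls n M (dagger F) = mat_adjoint (eval_cls n M F)"
  using assms by (auto simp: carrier_alg_A dagger_cls eval_cls ev_star)

end

section \<open>The cyclic model\<close>

lemma Suc_mod_inj:
  assumes "i < n" "j < n" "Suc i mod n = Suc j mod n"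
  shows "i = j"
  using assms by (auto simp: mod_Suc split: if_splits)

text \<open>The cyclic shift is an injective self-map of a finite set, hence a permutation. This
  reindexes products of shift matrices.\<close>

lemma sum_Suc_mod:
  assumes "0 < (n :: nat)"
  shows "(\<Sum>j<n. f (Suc j mod n)) = (\<Sum>j<n. f j)"
proof -
  have "inj_on (\<lambda>j. Suc j mod n) {..<n}"
    by (auto intro!: inj_onI dest: Suc_mod_inj)
  moreover have "(\<lambda>j. Suc j mod n) ` {..<n} = {..<n}"
    using assms calculation by (intro endo_inj_surj) auto
  ultimately show ?thesis
    by (metis sum.reindex_cong)
qed

lemma exp_i_eq_iff:
  "exp (\<i> * complex_of_real s) = exp (\<i> * complex_of_real t) \<longleftrightarrow> (\<exists>k::int. s = t + 2 * pi * k)"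
  using sin_cos_eq_iff[of s t] by (auto simp: cis_conv_exp[symmetric] complex_eq_iff)

text \<open>For k = 1 the number \<open>pi / real n\<close> is alpha/2, so \<open>C_norm\<close> is
  the modulus condition of \<open>T2_rep\<close>; \<open>n3\<close> keeps alpha/2 below
  pi/2.\<close>

locale cyclic_model =
  fixes n :: nat and R \<beta> :: real and C :: "nat \<Rightarrow> complex"
  assumes n3: "3 \<le> n"
    and C_nz: "m < n \<Longrightarrow> C m \<noteq> 0"
    and C_norm: "m < n \<Longrightarrow> (cmod (C m))\<^sup>2 =
      sec (pi / real n) * cos (\<beta> - pi / real n + real m * (2 * pi / real n)) + R"
begin

definition angle :: "nat \<Rightarrow> real" where
  "angle m = \<beta> + real m * (2 * pi / real n)"

text \<open>The entries that \<open>T2_rep\<close> prescribes for \<open>a_plus\<close> in the basis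
  of unit vectors, including the wrap from n - 1 to 0; \<open>down\<close> is the same for
  \<open>a_minus\<close>. Index pairs are the form in which \<open>Matrix.mat\<close> expects
  entries.\<close>

definition up :: "nat \<times> nat \<Rightarrow> complex" where
  "up = (\<lambda>(i, j). if i = Suc j mod n then cnj (C i) else 0)"

definition down :: "nat \<times> nat \<Rightarrow> complex" where
  "down = (\<lambda>(i, j). if j = Suc i mod n then C j else 0)"

definition eps :: real where
  "eps = tan (pi / real n)"

text \<open>The first two matrices solve x + iy = \<open>up\<close> and x - iy =
  \<open>down\<close>. The third is the imaginary part of the eigenvalues prescribed for u = w + iz;
  that w has the matching real part is then a computation, \<open>ev_w\<close>.\<close>

fun gen_mat :: "letter \<Rightarrow> complex mat" where
  "gen_mat X = Matrix.mat n n (\<lambda>ij. (up ij + down ij) / 2)"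
| "gen_mat Y = Matrix.mat n n (\<lambda>ij. (up ij - down ij) / (2 * \<i>))"
| "gen_mat Z = mat_diag n (\<lambda>m. complex_of_real (sin (angle m)))"
| "gen_mat E = mat_diag n (\<lambda>m. complex_of_real eps)"
| "gen_mat Einv = mat_diag n (\<lambda>m. 1 / complex_of_real (1 + eps\<^sup>2))"

sublocale matrix_assignment n gen_mat
proof
  show "gen_mat g \<in> carrier_mat n n" for g
    by (cases g) simp_all
qed

lemma cos_half_pos: "0 < cos (pi / real n)"
  using n3 by (intro cos_gt_zero) (auto simp: field_simps)

text \<open>The wrap from n - 1 to 0 drops one full turn, so k is -1 there and 0 elsewhere.\<close>

lemma angle_Suc_mod:
  assumes "m < n"
  obtains k :: int where "angle (Suc m mod n) = angle m + 2 * pi / real n + 2 * pi * k"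
proof (cases "Suc m = n")
  case True
  have "real (Suc m) * (2 * pi / real n) = 2 * pi"
    using True n3 by simp
  then have "real m * (2 * pi / real n) = 2 * pi - 2 * pi / real n"
    by (simp only: of_nat_Suc distrib_right)
  then have "angle (Suc m mod n) = angle m + 2 * pi / real n + 2 * pi * of_int (- 1)"
    using True by (simp add: angle_def)
  then show thesis
    by (rule that)
next
  case False
  then have "angle (Suc m mod n) = angle m + 2 * pi / real n + 2 * pi * of_int 0"
    using assms n3 by (simp add: angle_def field_simps)
  then show thesis
    by (rule that)
qed

text \<open>Full turns are invisible to sine and cosine. The offset \<open>t\<close> makes room for
  the half step inside the modulus of \<open>C\<close>.\<close>

lemma cos_sin_shift:
  assumes "m < n"
  shows "cos (angle (Suc m mod n) + t) = cos (angle m + 2 * pi / real n + t)"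
    and "sin (angle (Suc m mod n) + t) = sin (angle m + 2 * pi / real n + t)"
proof -
  obtain k :: int where k: "angle (Suc m mod n) = angle m + 2 * pi / real n + 2 * pi * k"
    using angle_Suc_mod[OF assms] .
  have "angle (Suc m mod n) + t = (angle m + 2 * pi / real n + t) + 2 * pi * k"
    using k by simp
  then show "cos (angle (Suc m mod n) + t) = cos (angle m + 2 * pi / real n + t)"
    and "sin (angle (Suc m mod n) + t) = sin (angle m + 2 * pi / real n + t)"
    using sin_cos_eq_iff by blast+
qed

lemma C_mult_cnj:
  assumes "m < n"
  shows "C m * cnj (C m) = complex_of_real (sec (pi / real n) * cos (angle m - pi / real n) + R)"
  using C_norm[OF assms] unfolding complex_norm_square[symmetric]
  by (simp add: angle_def algebra_simps)

text \<open>Half a step below the next angle is half a step above the current one. The diagonal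
  entries of a_+ a_- and a_- a_+ thus sit symmetrically about \<open>angle m\<close>.\<close>

lemma C_Suc_mult_cnj:
  assumes "m < n"
  shows "C (Suc m mod n) * cnj (C (Suc m mod n)) =
    complex_of_real (sec (pi / real n) * cos (angle m + pi / real n) + R)"
proof -
  have "angle m + 2 * pi / real n + - (pi / real n) = angle m + pi / real n"
    by (simp add: field_simps)
  then have "cos (angle (Suc m mod n) - pi / real n) = cos (angle m + pi / real n)"
    using cos_sin_shift(1)[OF assms, of "- (pi / real n)"] by (simp only: diff_conv_add_uminus)
  then show ?thesis
    using C_mult_cnj[of "Suc m mod n"] n3 by simp
qed

lemma sum_up_down:
  assumes "i < n" "l < n"
  shows "(\<Sum>j<n. up (i, j) * down (j, l)) = (if i = l then C i * cnj (C i) else 0)"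
proof -
  \<comment> \<open>The summand depends on j only through its cyclic successor, which must be
    i.\<close>
  have "(\<Sum>j<n. up (i, j) * down (j, l)) =
      (\<Sum>j<n. (\<lambda>j. if j = i then (if i = l then C i * cnj (C i) else 0) else 0) (Suc j mod n))"
    by (intro sum.cong) (auto simp: up_def down_def)
  also have "\<dots> = (\<Sum>j<n. if j = i then (if i = l then C i * cnj (C i) else 0) else 0)"
    using n3 by (subst sum_Suc_mod) auto
  finally show ?thesis
    using assms by simp
qed

lemma sum_down_up:
  assumes "i < n" "l < n"
  shows "(\<Sum>j<n. down (i, j) * up (j, l)) =
    (if i = l then C (Suc i mod n) * cnj (C (Suc i mod n)) else 0)"
proof -
  have "(\<Sum>j<n. down (i, j) * up (j, l)) = (\<Sum>j<n. if j = Suc i mod n then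
      (if i = l then C (Suc i mod n) * cnj (C (Suc i mod n)) else 0) else 0)"
    using assms by (intro sum.cong) (auto simp: up_def down_def dest: Suc_mod_inj)
  then show ?thesis
    using n3 by simp
qed

text \<open>With h = pi/n, cos(t - h) + cos(t + h) = 2 cos t cos h, and the secant removes cos h. In
  the algebra this is a_+ a_- + a_- a_+ = 2(x^2 + y^2) = 2(w + R).\<close>

lemma sum_up_down_cos:
  assumes "i < n" "l < n"
  shows "(\<Sum>j<n. up (i, j) * down (j, l)) + (\<Sum>j<n. down (i, j) * up (j, l)) =
    (if i = l then complex_of_real (2 * (cos (angle i) + R)) else 0)"
proof -
  have "sec (pi / real n) * cos (angle i - pi / real n) +
      sec (pi / real n) * cos (angle i + pi / real n) = 2 * cos (angle i)"
    using cos_half_pos by (simp add: sec_def cos_add cos_diff field_simps)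
  then have "(sec (pi / real n) * cos (angle i - pi / real n) + R) +
      (sec (pi / real n) * cos (angle i + pi / real n) + R) = 2 * (cos (angle i) + R)"
    by simp
  then show ?thesis
    using assms unfolding sum_up_down[OF assms] sum_down_up[OF assms]
    by (simp only: C_mult_cnj C_Suc_mult_cnj flip: of_real_add split: if_split) simp
qed

text \<open>Here cos(t + h) - cos(t - h) = -2 sin t sin h, and the secant turns sin h into
  \<open>eps\<close>. As a_- a_+ - a_+ a_- = 2i[x, y], this is the relation for [x, y].\<close>

lemma sum_down_up_sin:
  assumes "i < n" "l < n"
  shows "(\<Sum>j<n. down (i, j) * up (j, l)) - (\<Sum>j<n. up (i, j) * down (j, l)) =
    (if i = l then - complex_of_real (2 * eps * sin (angle i)) else 0)"
proof -
  have "(sec (pi / real n) * cos (angle i + pi / real n) + R) -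
      (sec (pi / real n) * cos (angle i - pi / real n) + R) = - (2 * eps * sin (angle i))"
    using cos_half_pos by (simp add: sec_def eps_def tan_def cos_add cos_diff field_simps)
  then show ?thesis
    using assms unfolding sum_up_down[OF assms] sum_down_up[OF assms]
    by (simp only: C_mult_cnj C_Suc_mult_cnj flip: of_real_diff of_real_minus split: if_split) simp
qed

section \<open>The defining relations in the cyclic model\<close>

lemma ev_w: "ev (w_el R) = mat_diag n (\<lambda>m. complex_of_real (cos (angle m)))"
proof (rule eq_matI)
  fix i l
  assume "i < dim_row (mat_diag n (\<lambda>m. complex_of_real (cos (angle m))))"
    "l < dim_col (mat_diag n (\<lambda>m. complex_of_real (cos (angle m))))"
  then have il: "i < n" "l < n"
    by (simp_all add: mat_diag_def)
  have "ev (w_el R) $$ (i, l) =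
      (\<Sum>j<n. (up (i, j) + down (i, j)) / 2 * ((up (j, l) + down (j, l)) / 2)) +
      (\<Sum>j<n. (up (i, j) - down (i, j)) / (2 * \<i>) * ((up (j, l) - down (j, l)) / (2 * \<i>))) -
      (if i = l then complex_of_real R else 0)"
    using il by (simp add: w_el_def ev_add ev_diff ev_mult ev_gen ev_scal scalar_prod_def
      atLeast0LessThan)
  \<comment> \<open>In x^2 + y^2 the squares of \<open>up\<close> and \<open>down\<close> cancel;
    only the mixed products survive.\<close>
  also have "\<dots> = ((\<Sum>j<n. up (i, j) * down (j, l)) + (\<Sum>j<n. down (i, j) * up (j, l))) / 2 -
      (if i = l then complex_of_real R else 0)"
    unfolding sum.distrib[symmetric] sum_divide_distrib
    by (intro arg_cong2[where f = minus] sum.cong refl) (simp add: field_simps)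
  also have "\<dots> = (if i = l then complex_of_real (cos (angle i)) else 0)"
    unfolding sum_up_down_cos[OF il] by (simp add: add_divide_distrib)
  finally show "ev (w_el R) $$ (i, l) =
      mat_diag n (\<lambda>m. complex_of_real (cos (angle m))) $$ (i, l)"
    using il by (simp add: mat_diag_def)
qed (simp_all add: mat_diag_def)

lemma ev_commutator_XY: "ev (commutator (gen X) (gen Y)) =
  mat_diag n (\<lambda>m. \<i> * complex_of_real eps * complex_of_real (sin (angle m)))" (is "_ = ?D")
proof (rule eq_matI)
  fix i l
  assume "i < dim_row ?D" "l < dim_col ?D"
  then have il: "i < n" "l < n"
    by (simp_all add: mat_diag_def)
  have "ev (commutator (gen X) (gen Y)) $$ (i, l) =
      (\<Sum>j<n. (up (i, j) + down (i, j)) / 2 * ((up (j, l) - down (j, l)) / (2 * \<i>))) -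
      (\<Sum>j<n. (up (i, j) - down (i, j)) / (2 * \<i>) * ((up (j, l) + down (j, l)) / 2))"
    using il by (simp add: ev_diff ev_mult ev_gen scalar_prod_def atLeast0LessThan)
  also have "\<dots> = ((\<Sum>j<n. down (i, j) * up (j, l)) - (\<Sum>j<n. up (i, j) * down (j, l))) / (2 * \<i>)"
    unfolding sum_subtractf[symmetric] sum_divide_distrib
    by (intro sum.cong refl) (simp add: field_simps)
  also have "\<dots> = (if i = l then \<i> * complex_of_real eps * complex_of_real (sin (angle i)) else 0)"
    unfolding sum_down_up_sin[OF il] by (simp add: field_simps)
  finally show "ev (commutator (gen X) (gen Y)) $$ (i, l) = ?D $$ (i, l)"
    using il by (simp add: mat_diag_def)
qed (simp_all add: mat_diag_def)

text \<open>Neighbouring angles are c - h and c + h modulo full turns, and sin(c + h) - sin(c - h) =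
  2 cos c sin h = tan h (cos(c + h) + cos(c - h)). Away from cyclic neighbours the entry is 0. The
  relations for [y, z] and [z, x] reduce to this, separately for \<open>up\<close> and
  \<open>down\<close>.\<close>

lemma up_down_sin_cos:
  assumes "i < n" "j < n"
  shows "up (i, j) * (sin (angle j) - sin (angle i)) =
      - (up (i, j) * (eps * (cos (angle i) + cos (angle j))))"
    and "down (i, j) * (sin (angle j) - sin (angle i)) =
      down (i, j) * (eps * (cos (angle i) + cos (angle j)))"
proof -
  have *: "sin (angle (Suc m mod n)) - sin (angle m) =
      eps * (cos (angle m) + cos (angle (Suc m mod n)))" if "m < n" for m
  proof -
    define h where "h = pi / real n"
    define c where "c = angle m + h"
    have "angle m = c - h" "angle m + 2 * pi / real n = c + h"
      by (simp_all add: c_def h_def field_simps)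
    then have "sin (angle (Suc m mod n)) = sin (c + h)" "cos (angle (Suc m mod n)) = cos (c + h)"
      and "sin (angle m) = sin (c - h)" "cos (angle m) = cos (c - h)"
      using cos_sin_shift[OF that, of 0] by (simp_all only: add_0_right)
    moreover have "0 < cos h"
      using cos_half_pos by (simp add: h_def)
    ultimately show ?thesis
      unfolding eps_def tan_def h_def[symmetric]
      by (simp only: sin_add sin_diff cos_add cos_diff) (simp add: field_simps)
  qed
  show "up (i, j) * (sin (angle j) - sin (angle i)) =
      - (up (i, j) * (eps * (cos (angle i) + cos (angle j))))"
  proof (cases "i = Suc j mod n")
    case True
    then have "sin (angle j) - sin (angle i) = - (eps * (cos (angle i) + cos (angle j)))"
      using *[OF assms(2)] by (simp add: algebra_simps)
    then show ?thesis
      by (simp flip: of_real_diff of_real_add of_real_mult)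
  qed (simp add: up_def)
  show "down (i, j) * (sin (angle j) - sin (angle i)) =
      down (i, j) * (eps * (cos (angle i) + cos (angle j)))"
  proof (cases "j = Suc i mod n")
    case True
    then have "sin (angle j) - sin (angle i) = eps * (cos (angle i) + cos (angle j))"
      using *[OF assms(1)] by simp
    then show ?thesis
      by (simp flip: of_real_diff of_real_add of_real_mult)
  qed (simp add: down_def)
qed

lemma ev_i_E: "ev (scal \<i> * gen E) = mat_diag n (\<lambda>m. \<i> * complex_of_real eps)"
  by (simp add: ev_scal_mult ev_gen) (auto simp: mat_diag_def intro!: eq_matI)

lemma ev_commutator_YZ:
  "ev (commutator (gen Y) (gen Z) - scal \<i> * gen E * (w_el R * gen X + gen X * w_el R)) = 0\<^sub>m n n"
proof (rule eq_matI)
  fix i j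
  assume "i < dim_row (0\<^sub>m n n :: complex mat)" "j < dim_col (0\<^sub>m n n :: complex mat)"
  then have ij: "i < n" "j < n"
    by simp_all
  let ?s = "\<lambda>m. complex_of_real (sin (angle m))" and ?c = "\<lambda>m. complex_of_real (cos (angle m))"
  \<comment> \<open>The images of z and w are diagonal: entry (i, j) of a commutator with z carries
    a difference of sines, that of an anticommutator with w a sum of cosines.\<close>
  have "ev (commutator (gen Y) (gen Z) - scal \<i> * gen E * (w_el R * gen X + gen X * w_el R)) $$ (i, j) =
      (up (i, j) * (?s j - ?s i) - down (i, j) * (?s j - ?s i)) / (2 * \<i>) -
      \<i> * (up (i, j) * (eps * (?c i + ?c j)) + down (i, j) * (eps * (?c i + ?c j))) / 2"
    using ij unfolding ev_diff ev_mult[of "scal \<i> * gen E"] ev_i_E ev_add ev_mult[of "w_el R"]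
      ev_mult[of "gen _"] ev_w ev_gen gen_mat.simps
    by (simp add: mat_diag_mult_left[of _ n n] mat_diag_mult_right[of _ n n] field_simps)
  also have "\<dots> = 0"
    unfolding up_down_sin_cos[OF ij, unfolded of_real_diff of_real_add of_real_mult]
    by (simp add: field_simps)
  finally show "ev (commutator (gen Y) (gen Z) -
      scal \<i> * gen E * (w_el R * gen X + gen X * w_el R)) $$ (i, j) = 0\<^sub>m n n $$ (i, j)"
    using ij by simp
qed simp_all

lemma ev_commutator_ZX:
  "ev (commutator (gen Z) (gen X) - scal \<i> * gen E * (w_el R * gen Y + gen Y * w_el R)) = 0\<^sub>m n n"
proof (rule eq_matI)
  fix i j
  assume "i < dim_row (0\<^sub>m n n :: complex mat)" "j < dim_col (0\<^sub>m n n :: complex mat)"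
  then have ij: "i < n" "j < n"
    by simp_all
  let ?s = "\<lambda>m. complex_of_real (sin (angle m))" and ?c = "\<lambda>m. complex_of_real (cos (angle m))"
  have "ev (commutator (gen Z) (gen X) - scal \<i> * gen E * (w_el R * gen Y + gen Y * w_el R)) $$ (i, j) =
      - (up (i, j) * (?s j - ?s i) + down (i, j) * (?s j - ?s i)) / 2 -
      (up (i, j) * (eps * (?c i + ?c j)) - down (i, j) * (eps * (?c i + ?c j))) / 2"
    using ij unfolding ev_diff ev_mult[of "scal \<i> * gen E"] ev_i_E ev_add ev_mult[of "w_el R"]
      ev_mult[of "gen _"] ev_w ev_gen gen_mat.simps
    by (simp add: mat_diag_mult_left[of _ n n] mat_diag_mult_right[of _ n n] field_simps)
  also have "\<dots> = 0"
    unfolding up_down_sin_cos[OF ij, unfolded of_real_diff of_real_add of_real_mult]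
    by (simp add: field_simps)
  finally show "ev (commutator (gen Z) (gen X) -
      scal \<i> * gen E * (w_el R * gen Y + gen Y * w_el R)) $$ (i, j) = 0\<^sub>m n n $$ (i, j)"
    using ij by simp
qed simp_all

sublocale relator_model n gen_mat R
proof
  fix r
  assume r: "r \<in> relators R"
  have comm: "ev (commutator (gen E) (gen g)) = 0\<^sub>m n n" for g
    unfolding ev_diff ev_mult ev_gen gen_mat.simps
    by (rule eq_matI)
      (auto simp: mat_diag_mult_left[OF M_carrier] mat_diag_mult_right[OF M_carrier])
  have eps_nz: "1 + (complex_of_real eps)\<^sup>2 \<noteq> 0"
  proof -
    have "1 + eps\<^sup>2 \<noteq> 0"
      by (smt (verit) zero_le_power2)
    then show ?thesis
      by (metis of_real_1 of_real_add of_real_eq_0_iff of_real_power)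
  qed
  have one_E: "ev (1 + gen E * gen E) = mat_diag n (\<lambda>m. 1 + (complex_of_real eps)\<^sup>2)"
    by (simp add: ev_add ev_one ev_mult ev_gen)
      (auto simp: mat_diag_def power2_eq_square intro!: eq_matI)
  have inv: "ev ((1 + gen E * gen E) * gen Einv - 1) = 0\<^sub>m n n"
    "ev (gen Einv * (1 + gen E * gen E) - 1) = 0\<^sub>m n n"
    using eps_nz by (auto simp: ev_diff ev_mult one_E ev_gen ev_one)
  have XY: "ev (commutator (gen X) (gen Y) - scal \<i> * gen E * gen Z) = 0\<^sub>m n n"
    unfolding ev_diff[of "commutator (gen X) (gen Y)"] ev_commutator_XY
      ev_mult[of "scal \<i> * gen E"] ev_i_E
    by (auto simp: ev_gen)
  have "complex_of_real ((sin t)\<^sup>2 + (cos t)\<^sup>2) = 1" for t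
    by simp
  then have "complex_of_real (sin t) * complex_of_real (sin t) +
      complex_of_real (cos t) * complex_of_real (cos t) = 1" for t
    by (simp only: power2_eq_square of_real_add of_real_mult)
  then have ZW: "ev (gen Z * gen Z + w_el R * w_el R - 1) = 0\<^sub>m n n"
    by (simp add: ev_diff ev_add ev_mult ev_w ev_gen ev_one)
      (auto simp: mat_diag_def intro!: eq_matI)
  show "ev r = 0\<^sub>m n n"
    using r comm inv XY ev_commutator_YZ ev_commutator_ZX ZW unfolding relators_def by blast
qed

end

text \<open>The characteristic polynomial splits into linear factors with distinct roots; once the
  factor at the eigenvalue is removed, the rest does not vanish there. This supplies the simple
  spectrum of u.\<close>

lemma order_mat_diag:
  fixes d :: "nat \<Rightarrow> 'a :: field"
  assumes inj: "inj_on d {..<n}" and ev: "eigenvalue (mat_diag n d) \<mu>"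
  shows "Polynomial.order \<mu> (char_poly (mat_diag n d)) = 1"
proof -
  have cp: "char_poly (mat_diag n d) = (\<Prod>i<n. [:- d i, 1:])"
  proof -
    have "char_poly (mat_diag n d) = (\<Prod>a\<leftarrow>diag_mat (mat_diag n d). [:- a, 1:])"
      by (rule char_poly_upper_triangular[of _ n]) (auto simp: mat_diag_def)
    also have "diag_mat (mat_diag n d) = map d [0..<n]"
      by (auto simp: diag_mat_def mat_diag_def)
    finally show ?thesis
      by (simp add: comp_def prod.list_conv_set_nth atLeast0LessThan)
  qed
  have "poly (char_poly (mat_diag n d)) \<mu> = 0"
    using eigenvalue_root_char_poly[of "mat_diag n d" n] ev by simp
  then obtain m where m: "m < n" "\<mu> = d m"
    by (auto simp: cp poly_prod)
  let ?q = "\<Prod>i\<in>{..<n} - {m}. [:- d i, 1:]"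
  have split: "char_poly (mat_diag n d) = [:- \<mu>, 1:] * ?q"
    using m by (simp only: cp prod.remove[of "{..<n}" m] finite_lessThan lessThan_iff)
  have nz: "poly ?q \<mu> \<noteq> 0"
    using m inj by (auto simp: poly_prod inj_on_def)
  then have "?q \<noteq> 0"
    by auto
  then have "[:- \<mu>, 1:] * ?q \<noteq> 0"
    by (simp only: mult_eq_0_iff) auto
  then have "Polynomial.order \<mu> ([:- \<mu>, 1:] * ?q) =
      Polynomial.order \<mu> [:- \<mu>, 1:] + Polynomial.order \<mu> ?q"
    by (rule order_mult)
  also have "Polynomial.order \<mu> [:- \<mu>, 1:] = 1"
    using order_power_n_n[of \<mu> 1] by simp
  also have "Polynomial.order \<mu> ?q = 0"
    using nz by (rule order_0I)
  finally show ?thesis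
    unfolding split by simp
qed

lemma mult_unit_vec_index:
  fixes A :: "'a :: semiring_1 mat"
  assumes "A \<in> carrier_mat n n" "i < n" "m < n"
  shows "(A *\<^sub>v unit_vec n m) $ i = A $$ (i, m)"
  using assms by (auto simp: scalar_prod_right_unit)

lemma unit_vec_orthonormal:
  assumes "l < n" "m < n"
  shows "(unit_vec n l :: complex vec) \<bullet>c unit_vec n m = (if l = m then 1 else 0)"
proof -
  have "conjugate (unit_vec n m :: complex vec) = unit_vec n m"
    using assms by (intro eq_vecI) auto
  then show ?thesis
    using assms by (auto simp: scalar_prod_left_unit)
qed

section \<open>The representation defined by the cyclic model\<close>

context cyclic_model
begin

definition rep :: "free_alg set \<Rightarrow> complex mat" where
  "rep = eval_cls n gen_mat"

definition phase :: "nat \<Rightarrow> complex" where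
  "phase m = exp (\<i> * of_real (\<beta> + real m * (2 * pi / real n)))"

lemma rep_cls: "rep (cls R f) = ev f"
  by (simp add: rep_def eval_cls)

lemma ev_a_plus: "ev a_plus = Matrix.mat n n up"
  by (rule eq_matI) (auto simp: a_plus_def ev_add ev_scal_mult ev_gen field_simps)

lemma ev_a_minus: "ev a_minus = Matrix.mat n n down"
  by (rule eq_matI) (auto simp: a_minus_def ev_diff ev_scal_mult ev_gen field_simps)

lemma ev_u: "ev (u_el R) = mat_diag n phase"
proof -
  have "phase m = of_real (cos (angle m)) + \<i> * of_real (sin (angle m))" for m
    unfolding phase_def angle_def cis_conv_exp[symmetric] by (simp add: complex_eq_iff)
  then show ?thesis
    by (intro eq_matI) (auto simp: u_el_def ev_add ev_scal_mult ev_gen ev_w mat_diag_def)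
qed

text \<open>The angles are spaced by 2 pi / n, so equal phases mean labels congruent modulo n. Both
  the simple spectrum and irreducibility rest on this.\<close>

lemma inj_phase: "inj_on phase {..<n}"
proof (rule inj_onI)
  fix l m
  assume lm: "l \<in> {..<n}" "m \<in> {..<n}" and "phase l = phase m"
  then obtain k :: int where
    "\<beta> + real l * (2 * pi / real n) = \<beta> + real m * (2 * pi / real n) + 2 * pi * k"
    by (auto simp: phase_def exp_i_eq_iff simp del: of_real_add of_real_mult)
  then have "2 * pi * real l = 2 * pi * (real m + real n * k)"
    using n3 by (simp add: field_simps)
  then have "real_of_int (int l) = real_of_int (int m + int n * k)"
    by simp
  then have "int l = int m + int n * k"
    by (simp only: of_int_eq_iff)
  then have "int l mod int n = int m mod int n"
    by simp
  then show "l = m"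
    using lm by simp
qed

lemma ev_a_plus_unit:
  assumes "m < n"
  shows "ev a_plus *\<^sub>v unit_vec n m = cnj (C (Suc m mod n)) \<cdot>\<^sub>v unit_vec n (Suc m mod n)"
  using assms n3 by (intro eq_vecI) (auto simp: ev_a_plus mult_unit_vec_index up_def simp del: index_mult_mat_vec)

text \<open>Indexing by the predecessor lets one rule cover the wrap: m = n - 1 gives the action on
  basis vector 0.\<close>

lemma ev_a_minus_unit:
  assumes "m < n"
  shows "ev a_minus *\<^sub>v unit_vec n (Suc m mod n) = C (Suc m mod n) \<cdot>\<^sub>v unit_vec n m"
  using assms n3
  by (intro eq_vecI)
    (auto simp: ev_a_minus mult_unit_vec_index down_def simp del: index_mult_mat_vec dest: Suc_mod_inj)

lemma ev_u_unit:
  assumes "m < n"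
  shows "ev (u_el R) *\<^sub>v unit_vec n m = phase m \<cdot>\<^sub>v unit_vec n m"
  using assms
  by (intro eq_vecI)
    (auto simp: ev_u mult_unit_vec_index mat_diag_def simp del: index_mult_mat_vec)

text \<open>\<open>up\<close> and \<open>down\<close> are adjoint to each other, so their half-sum
  and their difference over 2i are Hermitian; the remaining generators are real diagonal.\<close>

lemma gen_mat_hermitian: "mat_adjoint (gen_mat g) = gen_mat g"
proof -
  have "cnj (up (j, i)) = down (i, j)" "cnj (down (j, i)) = up (i, j)" for i j
    by (auto simp: up_def down_def)
  then show ?thesis
    by (cases g; intro eq_matI)
      (auto simp: mat_adjoint_index mat_diag_def field_simps)
qed

text \<open>A vector of minimal support in an invariant subspace is a multiple of a basis vector:
  otherwise \<open>u - \<lambda>\<close>, with \<open>\<lambda>\<close> the eigenvalue of \<open>u\<close> at one of its coordinates, shrinks its support.\<close>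

lemma irreducible_rep: "irreducible_rep R n rep"
  unfolding irreducible_rep_def
proof (intro conjI allI impI)
  show "0 < n"
    using n3 by simp
  fix W
  assume W: "VectorSpace.subspace class_ring W (module_vec TYPE(complex) n) \<and>
    (\<forall>F\<in>carrier (alg_A R). \<forall>v\<in>W. rep F *\<^sub>v v \<in> W)"
  then interpret submodule class_ring W "module_vec TYPE(complex) n"
    by (simp add: VectorSpace.subspace_def)
  have Wsub: "W \<subseteq> carrier_vec n" and W0: "0\<^sub>v n \<in> W"
    and Wadd: "\<And>v w. v \<in> W \<Longrightarrow> w \<in> W \<Longrightarrow> v + w \<in> W"
    and Wsmult: "\<And>c v. v \<in> W \<Longrightarrow> c \<cdot>\<^sub>v v \<in> W"
    using subset zero_closed m_closed smult_closed by (auto simp: module_vec_simps)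
  have Wev: "ev f *\<^sub>v v \<in> W" if "v \<in> W" for f v
  proof -
    have "cls R f \<in> carrier (alg_A R)"
      by (simp add: carrier_alg_A)
    then have "rep (cls R f) *\<^sub>v v \<in> W"
      using W that by blast
    then show ?thesis
      by (simp add: rep_cls)
  qed
  show "W = {0\<^sub>v n} \<or> W = carrier_vec n"
  proof (cases "W = {0\<^sub>v n}")
    case False
    define supp where "supp v = {i. i < n \<and> v $ i \<noteq> 0}" for v :: "complex vec"
    have [simp]: "finite (supp v)" for v
      by (simp add: supp_def)
    obtain v\<^sub>0 where "v\<^sub>0 \<in> W \<and> v\<^sub>0 \<noteq> 0\<^sub>v n"
      using False W0 by auto
    from ex_has_least_nat[where P = "\<lambda>v. v \<in> W \<and> v \<noteq> 0\<^sub>v n", OF this, of "\<lambda>v. card (supp v)"]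
    obtain v where v: "v \<in> W" "v \<noteq> 0\<^sub>v n"
      and least: "\<And>v'. v' \<in> W \<Longrightarrow> v' \<noteq> 0\<^sub>v n \<Longrightarrow> card (supp v) \<le> card (supp v')"
      by auto
    have vn: "v \<in> carrier_vec n"
      using v Wsub by blast
    obtain i where i: "i < n" "v $ i \<noteq> 0"
      using v(2) vn by (metis carrier_vecD eq_vecI index_zero_vec)
    have others: "v $ j = 0" if "j < n" "j \<noteq> i" for j
    proof (rule ccontr)
      assume nz: "v $ j \<noteq> 0"
      define v' where "v' = ev (u_el R - scal (phase i)) *\<^sub>v v"
      have v'_index: "v' $ l = (phase l - phase i) * v $ l" if "l < n" for l
      proof -
        have "ev (u_el R - scal (phase i)) = mat_diag n (\<lambda>l. phase l - phase i)"
          by (rule eq_matI) (auto simp: ev_diff ev_u ev_scal mat_diag_def)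
        then have "v' $ l = (\<Sum>k<n. (if l = k then phase k - phase i else 0) * v $ k)"
          using that vn by (simp add: v'_def scalar_prod_def mat_diag_def atLeast0LessThan)
        also have "\<dots> = (\<Sum>k<n. if k = l then (phase l - phase i) * v $ l else 0)"
          by (intro sum.cong) auto
        finally show ?thesis
          using that by simp
      qed
      have "v' $ j \<noteq> 0"
        using v'_index[of j] nz inj_phase i that by (auto simp: inj_on_def)
      then have "v' \<noteq> 0\<^sub>v n"
        using that by auto
      moreover have "v' \<in> W"
        unfolding v'_def by (rule Wev[OF v(1)])
      ultimately have "card (supp v) \<le> card (supp v')"
        by (intro least)
      moreover have "supp v' \<subseteq> supp v" "i \<in> supp v" "i \<notin> supp v'"
        using i v'_index by (auto simp: supp_def)
      then have "card (supp v') < card (supp v)"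
        by (intro psubset_card_mono) auto
      ultimately show False
        by simp
    qed
    have "unit_vec n i = (1 / v $ i) \<cdot>\<^sub>v v"
      using i others vn by (intro eq_vecI) auto
    then have start: "unit_vec n i \<in> W"
      using Wsmult[OF v(1)] by simp
    \<comment> \<open>Since no \<open>C\<close> vanishes, \<open>a_plus\<close> carries the subspace
      from one basis vector to the next around the whole cycle.\<close>
    have step: "unit_vec n (Suc m mod n) \<in> W" if "m < n" "unit_vec n m \<in> W" for m
    proof -
      have "unit_vec n (Suc m mod n) = (1 / cnj (C (Suc m mod n))) \<cdot>\<^sub>v (ev a_plus *\<^sub>v unit_vec n m)"
        using C_nz[of "Suc m mod n"] n3 by (simp add: ev_a_plus_unit[OF that(1)] smult_smult_assoc)
      then show ?thesis
        using Wsmult[OF Wev[OF that(2)]] by simp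
    qed
    have units: "unit_vec n ((i + k) mod n) \<in> W" for k
    proof (induction k)
      case (Suc k)
      then show ?case
        using step[of "(i + k) mod n"] n3 by (simp add: mod_Suc_eq)
    qed (use i start in simp)
    \<comment> \<open>Going n - i + m steps forward from i ends at m modulo n.\<close>
    have unit: "unit_vec n m \<in> W" if "m < n" for m
      using units[of "n - i + m"] i that by simp
    have "x \<in> W" if x: "x \<in> carrier_vec n" for x
    proof -
      have "k \<le> n \<Longrightarrow> Matrix.vec n (\<lambda>i. if i < k then x $ i else 0) \<in> W" for k
      proof (induction k)
        case 0
        have "Matrix.vec n (\<lambda>i. 0) = (0\<^sub>v n :: complex vec)"
          by (intro eq_vecI) auto
        then show ?case
          using W0 by simp
      next
        case (Suc k)
        have "Matrix.vec n (\<lambda>i. if i < Suc k then x $ i else 0) =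
            Matrix.vec n (\<lambda>i. if i < k then x $ i else 0) + x $ k \<cdot>\<^sub>v unit_vec n k"
          using Suc.prems by (intro eq_vecI) (auto simp: less_Suc_eq)
        then show ?case
          using Suc unit[of k] by (simp add: Wadd Wsmult)
      qed
      from this[of n] have "Matrix.vec n (\<lambda>i. if i < n then x $ i else 0) \<in> W"
        by simp
      also have "Matrix.vec n (\<lambda>i. if i < n then x $ i else 0) = x"
        using x by (intro eq_vecI) auto
      finally show ?thesis .
    qed
    then show ?thesis
      using Wsub by blast
  qed simp
qed

lemma rep_angle: "rep_angle R n rep (2 * pi / real n)"
proof -
  have "gen_mat E = of_real (tan (pi / real n)) \<cdot>\<^sub>m 1\<^sub>m n"
    by (intro eq_matI) (auto simp: mat_diag_def eps_def)
  then show ?thesis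
    using n3 by (simp add: rep_angle_def rep_cls ev_gen field_simps)
qed

lemma admissible_rep: "admissible_rep R n rep"
proof -
  have "tan (pi / real n) > 0"
    using n3 by (intro tan_gt_zero) (auto simp: field_simps)
  then have "\<exists>\<epsilon>::real. \<epsilon> > 0 \<and> rep (cls R (gen E)) = of_real \<epsilon> \<cdot>\<^sub>m 1\<^sub>m n"
    using rep_angle by (auto simp: rep_angle_def)
  then show ?thesis
    unfolding admissible_rep_def
    using representation_eval_cls irreducible_rep order_mat_diag[OF inj_phase]
      eval_cls_dagger[OF gen_mat_hermitian]
    by (simp add: rep_cls ev_u) (simp add: rep_def)
qed

lemma minimal_rep: "minimal_rep R n rep"
  unfolding minimal_rep_def using rep_angle n3 by (intro exI[of _ "2 * pi / real n"]) simp

lemma T2_rep: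
  assumes "\<nu> = (\<Prod>m<n. C m) / of_real (cmod (\<Prod>m<n. C m))"
  shows "T2_rep R n 1 \<beta> \<nu> rep"
proof -
  have "(\<Prod>m<n. C m) \<noteq> 0"
    using C_nz by simp
  then have "cmod \<nu> = 1"
    by (simp add: assms norm_divide)
  moreover have "2 * 1 < n" "coprime n 1"
    using n3 by simp_all
  moreover have "\<forall>m. 1 \<le> m \<and> m < n \<longrightarrow>
      ev a_minus *\<^sub>v unit_vec n m = C m \<cdot>\<^sub>v unit_vec n (m - 1)"
    using ev_a_minus_unit by (metis Suc_diff_1 diff_less less_imp_diff_less mod_less One_nat_def
      Suc_le_eq)
  moreover have "\<forall>m. m + 1 < n \<longrightarrow>
      ev a_plus *\<^sub>v unit_vec n m = cnj (C (m + 1)) \<cdot>\<^sub>v unit_vec n (m + 1)"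
    using ev_a_plus_unit by simp
  moreover have "ev a_minus *\<^sub>v unit_vec n 0 = C 0 \<cdot>\<^sub>v unit_vec n (n - 1)"
    using ev_a_minus_unit[of "n - 1"] n3 by simp
  moreover have "ev a_plus *\<^sub>v unit_vec n (n - 1) = cnj (C 0) \<cdot>\<^sub>v unit_vec n 0"
    using ev_a_plus_unit[of "n - 1"] n3 by simp
  moreover have "2 * pi / real n = 2 * pi * real 1 / real n"
    "2 * pi / real n / 2 = pi / real n"
    by simp_all
  ultimately show ?thesis
    unfolding T2_rep_def Let_def rep_cls
    using admissible_rep rep_angle ev_u_unit C_nz C_norm unit_vec_orthonormal assms
    by (intro conjI exI[of _ "2 * pi / real n"] exI[of _ "unit_vec n"] exI[of _ C] allI impI)
      (simp_all add: phase_def)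
qed

end

text \<open>U intertwines the two diagonal images of u, so a nonzero entry of U identifies an
  eigenvalue of one with an eigenvalue of the other.\<close>

lemma equivalent_cyclic_models:
  assumes "cyclic_model n R \<beta> C" "cyclic_model n R \<gamma> D"
    and "equivalent_reps R n (cyclic_model.rep n \<beta> C) (cyclic_model.rep n \<gamma> D)"
  obtains k :: int where "\<beta> = \<gamma> + k * (2 * pi / real n)"
proof -
  interpret a: cyclic_model n R \<beta> C by fact
  interpret b: cyclic_model n R \<gamma> D by fact
  obtain U where U: "U \<in> carrier_mat n n" "mat_adjoint U * U = 1\<^sub>m n"
    and "\<forall>F\<in>carrier (alg_A R). U * a.rep F = b.rep F * U"
    using assms(3) by (auto simp: equivalent_reps_def)
  then have "U * a.rep (cls R (u_el R)) = b.rep (cls R (u_el R)) * U"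
    by (auto simp: carrier_alg_A)
  then have eq: "U * mat_diag n a.phase = mat_diag n b.phase * U"
    by (simp add: a.rep_cls b.rep_cls a.ev_u b.ev_u)
  have n: "0 < n"
    using a.n3 by simp
  \<comment> \<open>If column 0 were zero, entry (0, 0) of \<open>mat_adjoint U * U\<close> would be
    0 instead of 1.\<close>
  have "\<exists>i<n. U $$ (i, 0) \<noteq> 0"
  proof (rule ccontr)
    assume "\<not> ?thesis"
    then have "(mat_adjoint U * U) $$ (0, 0) = 0"
      using U(1) n by (auto simp: scalar_prod_def)
    then show False
      using U(2) n by simp
  qed
  then obtain i where i: "i < n" "U $$ (i, 0) \<noteq> 0"
    by blast
  have "(U * mat_diag n a.phase) $$ (i, 0) = (mat_diag n b.phase * U) $$ (i, 0)"
    by (simp only: eq)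
  then have "a.phase 0 = b.phase i"
    using i n by (simp add: mat_diag_mult_left[OF U(1)] mat_diag_mult_right[OF U(1)])
  then obtain k :: int where "\<beta> = \<gamma> + real i * (2 * pi / real n) + 2 * pi * k"
    by (auto simp: a.phase_def b.phase_def exp_i_eq_iff simp del: of_real_add of_real_mult)
  then have "\<beta> = \<gamma> + of_int (int i + int n * k) * (2 * pi / real n)"
    using n by (simp add: field_simps)
  then show thesis
    by (rule that)
qed

section \<open>The range of the parameter\<close>

lemma T2_rep_positive:
  fixes m n k :: nat
  assumes "T2_rep R n k \<beta> \<nu> \<Psi>" "m < n"
  shows "0 < sec (pi * k / n) * cos (\<beta> - pi * k / n + real m * (2 * pi * k / n)) + R"
proof -
  obtain \<alpha> and C :: "nat \<Rightarrow> complex" where "\<alpha> = 2 * pi * real k / real n"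
    and "C m \<noteq> 0" "(cmod (C m))\<^sup>2 = sec (\<alpha> / 2) * cos (\<beta> - \<alpha> / 2 + real m * \<alpha>) + R"
    using assms unfolding T2_rep_def Let_def by blast
  moreover from this have "\<alpha> / 2 = pi * k / n"
    by simp
  ultimately show ?thesis
    by (metis zero_less_norm_iff zero_less_power)
qed

lemma cos_shift_le_neg_cos:
  assumes "coprime n k" "0 < n"
  obtains m where "m < n" "cos (b + real m * (2 * pi * k / n)) \<le> - cos (pi / n)"
proof -
  \<comment> \<open>\<open>j\<close> counts the steps of length 2 pi / n that bring b closest to pi;
    \<open>d\<close> is the remaining error in units of a step.\<close>
  define j where "j = round ((pi - b) * n / (2 * pi))"
  define d where "d = of_int j - (pi - b) * n / (2 * pi)"
  have "\<bar>d\<bar> \<le> 1 / 2"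
    unfolding d_def j_def by (rule of_int_round_abs_le)
  \<comment> \<open>By Bezout u inverts k modulo n, so the remainder of j u modulo n solves m k = j
    modulo n.\<close>
  obtain u v where uv: "u * int k + v * int n = 1"
    using bezout_int[of "int k" "int n"] assms(1) by (auto simp: coprime_commute coprime_iff_gcd_eq_1)
  define m where "m = nat ((j * u) mod int n)"
  have "m < n"
    using assms(2) by (simp add: m_def nat_less_iff)
  have "int m = j * u - int n * ((j * u) div int n)"
    using assms(2) by (simp add: m_def minus_mult_div_eq_mod)
  moreover have "j * (u * int k) = j - j * v * int n"
    using uv by (simp add: algebra_simps flip: distrib_left)
  moreover have "int m * int k = j * (u * int k) - int n * (k * ((j * u) div int n))"
    unfolding calculation(1) by (simp add: algebra_simps)
  ultimately have "int m * int k = j + int n * (- j * v - k * ((j * u) div int n))"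
    by (simp add: algebra_simps)
  then obtain t where "int (m * k) = j + int n * t"
    by auto
  then have t: "real m * real k = of_int j + real n * of_int t"
    by (metis of_int_add of_int_mult of_int_of_nat_eq of_nat_mult)
  have "b + real m * (2 * pi * k / n) = b + (real m * real k) * (2 * pi / n)"
    by simp
  also have "\<dots> = b + of_int j * (2 * pi / n) + 2 * pi * of_int t"
    unfolding t using assms(2) by (simp add: field_simps)
  also have "\<dots> = (pi + d * (2 * pi / n)) + 2 * pi * of_int t"
    using assms(2) by (simp add: d_def field_simps)
  finally have "cos (b + real m * (2 * pi * k / n)) = cos (pi + d * (2 * pi / n))"
    using sin_cos_eq_iff by blast
  also have "\<dots> = - cos \<bar>d * (2 * pi / n)\<bar>"
    unfolding cos_abs_real by (simp add: cos_add)
  also have "\<dots> \<le> - cos (pi / n)"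
  proof -
    have "\<bar>d * (2 * pi / n)\<bar> = \<bar>d\<bar> * (2 * pi / n)"
      by (simp add: abs_mult)
    also have "\<dots> \<le> 1 / 2 * (2 * pi / n)"
      using \<open>\<bar>d\<bar> \<le> 1 / 2\<close> by (intro mult_right_mono) auto
    finally have "\<bar>d * (2 * pi / n)\<bar> \<le> pi / n"
      by simp
    moreover have "pi / n \<le> pi"
      using assms(2) by (simp add: field_simps)
    ultimately have "cos (pi / n) \<le> cos \<bar>d * (2 * pi / n)\<bar>"
      by (intro cos_monotone_0_pi_le) auto
    then show ?thesis
      by simp
  qed
  finally show thesis
    using that \<open>m < n\<close> by blast
qed

text \<open>As 1 <= k < n/2, cos(pi k / n) is positive and at most cos(pi / n). At the label nearest
  to pi the secant term is therefore at most -1, and positivity demands R > 1.\<close>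

lemma no_T2_rep:
  assumes "R \<le> 1"
  shows "\<not> T2_rep R n k \<beta> \<nu> \<Psi>"
proof
  assume T2: "T2_rep R n k \<beta> \<nu> \<Psi>"
  then have k: "1 \<le> k" "2 * k < n" "coprime n k"
    by (auto simp: T2_rep_def)
  obtain m where m: "m < n" "cos (\<beta> - pi * k / n + real m * (2 * pi * k / n)) \<le> - cos (pi / n)"
    using cos_shift_le_neg_cos[of n k "\<beta> - pi * k / n"] k by auto
  have pos: "0 < cos (pi * k / n)"
    using k by (intro cos_gt_zero) (auto simp: field_simps)
  have "pi * 1 \<le> pi * real k"
    using k by (intro mult_left_mono) auto
  then have "cos (pi * k / n) \<le> cos (pi / n)"
    using k by (intro cos_monotone_0_pi_le) (auto simp: field_simps)
  then have "cos (\<beta> - pi * k / n + real m * (2 * pi * k / n)) \<le> - cos (pi * k / n)"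
    using m by linarith
  then have "sec (pi * k / n) * cos (\<beta> - pi * k / n + real m * (2 * pi * k / n)) \<le> - 1"
    using pos by (simp add: sec_def field_simps)
  then show False
    using T2_rep_positive[OF T2 m(1)] assms by linarith
qed

section \<open>Existence, inequivalence and completeness of the families\<close>

lemma cyclic_model_exists:
  assumes n: "3 \<le> n" and \<nu>: "cmod \<nu> = 1"
    and pos: "\<forall>m<n. 0 < sec (pi / n) * cos (\<beta> - pi / n + real m * (2 * pi / n)) + R"
  obtains C where "cyclic_model n R \<beta> C" "\<nu> = (\<Prod>m<n. C m) / of_real (cmod (\<Prod>m<n. C m))"
proof -
  define r where "r m = sqrt (sec (pi / n) * cos (\<beta> - pi / n + real m * (2 * pi / n)) + R)" for m
  \<comment> \<open>\<open>C 0\<close> carries the whole phase, so the product is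
    \<open>\<nu>\<close> times a positive real.\<close>
  define C where "C m = (if m = 0 then \<nu> else 1) * complex_of_real (r m)" for m
  have r: "0 < r m" if "m < n" for m
    using pos that by (simp add: r_def)
  have cmod_C: "cmod (C m) = r m" if "m < n" for m
    using r[OF that] \<nu> by (simp add: C_def norm_mult)
  have "cyclic_model n R \<beta> C"
  proof
    fix m
    assume m: "m < n"
    show "C m \<noteq> 0"
      using cmod_C[OF m] r[OF m] by auto
    show "(cmod (C m))\<^sup>2 = sec (pi / real n) * cos (\<beta> - pi / real n + real m * (2 * pi / real n)) + R"
      using cmod_C[OF m] r[OF m] by (simp add: r_def)
  qed (fact n)
  moreover have "\<nu> = (\<Prod>m<n. C m) / of_real (cmod (\<Prod>m<n. C m))"
  proof -
    have p: "0 < (\<Prod>m<n. r m)"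
      using r by (intro prod_pos) auto
    have "(\<Prod>m<n. C m) = \<nu> * of_real (\<Prod>m<n. r m)"
      using n by (simp add: C_def prod.distrib prod.delta)
    then show ?thesis
      using p \<nu> by (simp add: norm_mult del: of_real_prod prod_zero_iff)
  qed
  ultimately show thesis
    by (rule that)
qed

text \<open>Both ranges of R reduce to this positivity criterion: where it holds a cyclic model
  exists, and where it fails \<open>T2_rep_positive\<close> excludes a representation.\<close>

lemma minimal_T2_familyI:
  assumes n: "3 \<le> n" and \<nu>: "cmod \<nu> = 1" and sub: "B \<subseteq> normalised_betas n"
    and B: "\<And>\<beta>. \<beta> \<in> normalised_betas n \<Longrightarrow>
      \<beta> \<in> B \<longleftrightarrow> (\<forall>m<n. 0 < sec (pi / n) * cos (\<beta> - pi / n + real m * (2 * pi / n)) + R)"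
  shows "minimal_T2_family R n \<nu> B"
proof -
  have "\<exists>C. cyclic_model n R \<beta> C \<and> \<nu> = (\<Prod>m<n. C m) / of_real (cmod (\<Prod>m<n. C m))"
    if "\<beta> \<in> B" for \<beta>
  proof -
    have "\<forall>m<n. 0 < sec (pi / n) * cos (\<beta> - pi / n + real m * (2 * pi / n)) + R"
      using B[of \<beta>] sub that by (simp add: subset_iff)
    from cyclic_model_exists[OF n \<nu> this] show ?thesis
      by blast
  qed
  then have "\<forall>\<beta>\<in>B. \<exists>C. cyclic_model n R \<beta> C \<and>
      \<nu> = (\<Prod>m<n. C m) / of_real (cmod (\<Prod>m<n. C m))"
    by blast
  from bchoice[OF this] obtain C where C: "\<And>\<beta>. \<beta> \<in> B \<Longrightarrow> cyclic_model n R \<beta> (C \<beta>)"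
    and C\<nu>: "\<And>\<beta>. \<beta> \<in> B \<Longrightarrow> \<nu> = (\<Prod>m<n. C \<beta> m) / of_real (cmod (\<Prod>m<n. C \<beta> m))"
    by blast
  define \<Psi> where "\<Psi> \<beta> = cyclic_model.rep n \<beta> (C \<beta>)" for \<beta>
  have "irreducible_rep R n (\<Psi> \<beta>) \<and> T2_rep R n 1 \<beta> \<nu> (\<Psi> \<beta>) \<and> minimal_rep R n (\<Psi> \<beta>)"
    if "\<beta> \<in> B" for \<beta>
  proof -
    interpret cyclic_model n R \<beta> "C \<beta>"
      using that by (rule C)
    show ?thesis
      unfolding \<Psi>_def using irreducible_rep T2_rep[OF C\<nu>[OF that]] minimal_rep by blast
  qed
  moreover have "\<not> equivalent_reps R n (\<Psi> \<beta>) (\<Psi> \<gamma>)"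
    if members: "\<beta> \<in> B" "\<gamma> \<in> B" and "\<beta> \<noteq> \<gamma>" for \<beta> \<gamma>
  proof
    assume "equivalent_reps R n (\<Psi> \<beta>) (\<Psi> \<gamma>)"
    then obtain k :: int where k: "\<beta> = \<gamma> + k * (2 * pi / real n)"
      using equivalent_cyclic_models[OF C[OF members(1)] C[OF members(2)]] unfolding \<Psi>_def by blast
    \<comment> \<open>The normalised window is half-open of length 2 pi / n, so two members cannot
      differ by a nonzero multiple of the step.\<close>
    have "\<bar>\<beta> - \<gamma>\<bar> < 2 * pi / n"
    proof -
      have "\<beta> \<in> normalised_betas n" "\<gamma> \<in> normalised_betas n"
        using members sub by auto
      then show ?thesis
        unfolding normalised_betas_def Let_def mem_Collect_eq by linarith
    qed
    then have "\<bar>of_int k\<bar> * (2 * pi / n) < 1 * (2 * pi / n)"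
      by (simp add: k abs_mult)
    then have "\<bar>real_of_int k\<bar> < 1"
      by (rule mult_right_less_imp_less) simp
    then have "k = 0"
      by linarith
    then show False
      using k \<open>\<beta> \<noteq> \<gamma>\<close> by simp
  qed
  moreover have "\<not> T2_rep R n 1 \<beta> \<nu> \<Phi>" if "\<beta> \<in> normalised_betas n - B" for \<beta> \<Phi>
  proof
    assume "T2_rep R n 1 \<beta> \<nu> \<Phi>"
    then have "\<forall>m<n. 0 < sec (pi / n) * cos (\<beta> - pi / n + real m * (2 * pi / n)) + R"
      using T2_rep_positive[of R n 1 \<beta> \<nu> \<Phi>] by simp
    then show False
      using B[of \<beta>] that by blast
  qed
  ultimately show ?thesis
    unfolding minimal_T2_family_def by blast
qed

section \<open>The interval of beta cut out by positivity\<close>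

lemma cos_less_cos:
  assumes "0 \<le> d" "d < x" "x < 2 * pi - d"
  shows "cos x < cos d"
proof (cases "x \<le> pi")
  case True
  then show ?thesis
    using assms by (intro cos_monotone_0_pi) auto
next
  case False
  then have "cos (2 * pi - x) < cos d"
    using assms by (intro cos_monotone_0_pi) auto
  then show ?thesis
    by simp
qed

text \<open>Here \<open>d\<close> is delta/2. The expression equals (cos t + cos d) / cos(pi / n),
  so positivity says that the angle t stays farther than d from pi on the circle. The points around
  pi are b (m = 0, at or below it) and b + 2 pi / n (m = 1, above it); they give the two bounds, and
  the other points are no closer.\<close>

lemma positive_iff_beta_range:
  fixes b d :: real and n :: nat
  assumes n: "3 \<le> n" and d: "cos d = R * cos (pi / n)" "0 \<le> d" "d < pi / n"
    and b: "pi - 2 * pi / n < b" "b \<le> pi"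
  shows "(\<forall>m<n. 0 < sec (pi / n) * cos (b + real m * (2 * pi / n)) + R) \<longleftrightarrow>
    pi - 2 * pi / n + d < b \<and> b < pi - d"
proof -
  have c0: "0 < cos (pi / n)"
    using n by (intro cos_gt_zero) (auto simp: field_simps)
  have pos: "0 < sec (pi / n) * cos t + R \<longleftrightarrow> cos (pi - t) < cos d" for t
  proof -
    have "sec (pi / n) * cos t + R = (cos t + cos d) / cos (pi / n)"
      using c0 by (simp add: d(1) sec_def field_simps)
    then have "0 < sec (pi / n) * cos t + R \<longleftrightarrow> 0 < cos t + cos d"
      using c0 by (simp add: zero_less_divide_iff)
    then show ?thesis
      by (simp add: cos_diff) linarith
  qed
  have "pi / n \<le> pi"
    using n by (simp add: field_simps)
  then have "d \<le> pi"
    using d(3) by linarith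
  show ?thesis
  proof (intro iffI conjI)
    assume *: "\<forall>m<n. 0 < sec (pi / n) * cos (b + real m * (2 * pi / n)) + R"
    have 0: "cos (pi - b) < cos d"
      using *[rule_format, of 0] n unfolding pos by simp
    show "b < pi - d"
    proof (rule ccontr)
      assume "\<not> b < pi - d"
      then have "cos d \<le> cos (pi - b)"
        using b \<open>d \<le> pi\<close> d by (intro cos_monotone_0_pi_le) auto
      with 0 show False
        by simp
    qed
    have "cos (pi - (b + 2 * pi / n)) < cos d"
      using *[rule_format, of 1] n unfolding pos by simp
    then have 1: "cos (b + 2 * pi / n - pi) < cos d"
      by (metis cos_minus minus_diff_eq)
    show "pi - 2 * pi / n + d < b"
    proof (rule ccontr)
      assume "\<not> pi - 2 * pi / n + d < b"
      then have "cos d \<le> cos (b + 2 * pi / n - pi)"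
        using b \<open>d \<le> pi\<close> d by (intro cos_monotone_0_pi_le) auto
      with 1 show False
        by simp
    qed
  next
    assume *: "pi - 2 * pi / n + d < b \<and> b < pi - d"
    show "\<forall>m<n. 0 < sec (pi / n) * cos (b + real m * (2 * pi / n)) + R"
    proof (intro allI impI)
      fix m :: nat
      assume m: "m < n"
      have "cos (pi - (b + real m * (2 * pi / n))) < cos d"
      proof (cases "m = 0")
        case True
        have "2 * pi / n \<le> 2 * pi"
          using n by (simp add: field_simps)
        then show ?thesis
          using True * d by (intro cos_less_cos) auto
      next
        case False
        have "1 * (2 * pi / n) \<le> m * (2 * pi / n)"
          using False by (intro mult_right_mono) auto
        \<comment> \<open>The bound m + 1 <= n keeps the angle at least one step short of a full
          turn past b, as the upper bound of \<open>cos_less_cos\<close> requires.\<close>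
        moreover have "real (Suc m) * (2 * pi / n) \<le> n * (2 * pi / n)"
          using m by (intro mult_right_mono) auto
        then have "m * (2 * pi / n) + 2 * pi / n \<le> 2 * pi"
          using n by (simp only: of_nat_Suc distrib_right) simp
        ultimately have "cos (b + real m * (2 * pi / n) - pi) < cos d"
          using * d by (intro cos_less_cos) auto
        then show ?thesis
          by (metis cos_minus minus_diff_eq)
      qed
      then show "0 < sec (pi / n) * cos (b + real m * (2 * pi / n)) + R"
        unfolding pos .
    qed
  qed
qed

text \<open>The solution is 2 arccos(R cos(pi / n)): R <= sec(pi / n) keeps the argument at most 1,
  and R > 1 makes the angle smaller than 2 pi / n. Uniqueness holds because arccos inverts cosine on
  [0, pi].\<close>

lemma ex1_delta:
  assumes n: "3 \<le> n" and R: "1 < R" "R \<le> sec (pi / real n)"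
  shows "\<exists>!\<delta>. cos (\<delta> / 2) = R * cos (pi / real n) \<and> 0 \<le> \<delta> \<and> \<delta> < 2 * pi / real n"
proof -
  have pos: "0 < cos (pi / n)"
    using n by (intro cos_gt_zero) (auto simp: field_simps)
  have le_pi: "pi / n \<le> pi"
    using n by (simp add: field_simps)
  define y where "y = R * cos (pi / n)"
  have y: "cos (pi / n) < y" "y \<le> 1"
    using R pos by (auto simp: y_def sec_def field_simps)
  show ?thesis
  proof (rule ex1I)
    have "arccos y < arccos (cos (pi / n))"
      using y pos by (intro arccos_less_arccos) auto
    also have "arccos (cos (pi / n)) = pi / n"
      using le_pi by (intro arccos_cos) auto
    finally show "cos (2 * arccos y / 2) = R * cos (pi / real n) \<and>
        0 \<le> 2 * arccos y \<and> 2 * arccos y < 2 * pi / real n"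
      using y pos arccos_lbound[of y] by (simp add: y_def[symmetric])
  next
    fix \<delta>
    assume "cos (\<delta> / 2) = R * cos (pi / real n) \<and> 0 \<le> \<delta> \<and> \<delta> < 2 * pi / real n"
    then have "y = cos (\<delta> / 2)" "0 \<le> \<delta> / 2" "\<delta> / 2 \<le> pi"
      using le_pi by (simp_all add: y_def)
    then have "arccos y = \<delta> / 2"
      by (simp only: arccos_cos)
    then show "\<delta> = 2 * arccos y"
      by simp
  qed
qed

section \<open>The three ranges of R\<close>

theorem corollary11:
  fixes R :: real
  shows
    "(R \<le> 1 \<longrightarrow> \<not> (\<exists>n k \<beta> \<nu> \<Psi>. T2_rep R n k \<beta> \<nu> \<Psi>)) \<and>
     (\<forall>(n::nat) (\<nu>::complex). n \<ge> 3 \<and> cmod \<nu> = 1 \<longrightarrow>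
       (1 < R \<and> R \<le> sec (pi / real n) \<longrightarrow>
         (\<exists>!\<delta>. cos (\<delta> / 2) = R * cos (pi / real n) \<and> 0 \<le> \<delta> \<and> \<delta> < 2 * pi / real n) \<and>
         (\<forall>\<delta>. cos (\<delta> / 2) = R * cos (pi / real n) \<and> 0 \<le> \<delta> \<and> \<delta> < 2 * pi / real n \<longrightarrow>
           minimal_T2_family R n \<nu>
             {\<beta>. let \<alpha> = 2 * pi / real n; \<beta>' = \<beta> - \<alpha> / 2 in
               pi - 2 * pi / real n + \<delta> / 2 < \<beta>' \<and> \<beta>' < pi - \<delta> / 2})) \<and>
       (R > sec (pi / real n) \<longrightarrow> minimal_T2_family R n \<nu> (normalised_betas n)))"
proof (intro conjI allI impI)
  show "\<not> (\<exists>n k \<beta> \<nu> \<Psi>. T2_rep R n k \<beta> \<nu> \<Psi>)" if "R \<le> 1"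
    using no_T2_rep[OF that] by blast
next
  fix n :: nat and \<nu> :: complex
  assume n\<nu>: "n \<ge> 3 \<and> cmod \<nu> = 1" and R: "1 < R \<and> R \<le> sec (pi / real n)"
  then show "\<exists>!\<delta>. cos (\<delta> / 2) = R * cos (pi / real n) \<and> 0 \<le> \<delta> \<and> \<delta> < 2 * pi / real n"
    by (intro ex1_delta) auto
  fix \<delta>
  assume \<delta>: "cos (\<delta> / 2) = R * cos (pi / real n) \<and> 0 \<le> \<delta> \<and> \<delta> < 2 * pi / real n"
  then have half: "\<delta> / 2 < pi / n"
    by (simp add: field_simps)
  have "2 * pi / n / 2 = pi / n"
    by simp
  note betas = mem_Collect_eq Let_def this
  show "minimal_T2_family R n \<nu>
      {\<beta>. let \<alpha> = 2 * pi / real n; \<beta>' = \<beta> - \<alpha> / 2 in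
        pi - 2 * pi / real n + \<delta> / 2 < \<beta>' \<and> \<beta>' < pi - \<delta> / 2}" (is "minimal_T2_family R n \<nu> ?B")
  proof (rule minimal_T2_familyI)
    show "?B \<subseteq> normalised_betas n"
      using \<delta> by (auto simp: normalised_betas_def Let_def)
    fix \<beta>
    assume "\<beta> \<in> normalised_betas n"
    then show "\<beta> \<in> ?B \<longleftrightarrow> (\<forall>m<n. 0 < sec (pi / n) * cos (\<beta> - pi / n + real m * (2 * pi / n)) + R)"
      using positive_iff_beta_range[of n "\<delta> / 2" R "\<beta> - pi / n"] n\<nu> \<delta> half
      unfolding normalised_betas_def betas by simp
  qed (use n\<nu> in auto)
next
  fix n :: nat and \<nu> :: complex
  assume n\<nu>: "n \<ge> 3 \<and> cmod \<nu> = 1" and R: "R > sec (pi / real n)"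
  have "0 < cos (pi / n)"
    using n\<nu> by (intro cos_gt_zero) (auto simp: field_simps)
  then have sec_pos: "0 < sec (pi / n)"
    by (simp add: sec_def)
  \<comment> \<open>Beyond the secant, cos t >= -1 already gives positivity at every angle, so no
    normalised beta is excluded.\<close>
  have "0 < sec (pi / n) * cos t + R" for t
  proof -
    have "sec (pi / n) * (- 1) \<le> sec (pi / n) * cos t"
      using sec_pos by (intro mult_left_mono) auto
    then show ?thesis
      using R by linarith
  qed
  then show "minimal_T2_family R n \<nu> (normalised_betas n)"
    using n\<nu> by (intro minimal_T2_familyI) auto
qed

end
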